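(* Let $X$ be an infinite-dimensional complex Banach space. For every $T\in L(X)$, $$\sigma_{g_zd}(T)=\mathrm{acc}\,(\mathrm{acc}\,\sigma(T)),$$ where $\sigma_{g_zd}(T)=\{\lambda\in\mathbb{C}: T-\lambda I\text{ is not } g_z\text{-invertible}\}$.
   Context: $L(X)$ is the algebra of bounded linear operators on $X$. $\mathrm{acc}\,A$ is the set of accumulation points of $A\subset\mathbb{C}$. An operator $S$ on a Banach space is zeroloid if $\mathrm{acc}\,\sigma(S)\subset\{0\}$. $T_M$ is the restriction of $T$ to a $T$-invariant subspace $M$. $(M,N)\in\mathrm{Red}(T)$ means that $M,N$ are closed $T$-invariant subspaces (possibly $\{0\}$) with $X=M\oplus N$. $T$ is left (resp. right) $g_z$-invertible if there is $(M,N)\in\mathrm{Red}(T)$ such that $T_M$ is bounded below (resp. surjective) and $T_N$ is zeroloid. $T$ is $g_z$-invertible if it is both left and right $g_z$-invertible; equivalently, there is $(M,N)\in\mathrm{Red}(T)$ such that $T_M$ is invertible and $T_N$ is zeroloid. *)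

theory Defs
  imports "HOL-Analysis.Analysis"
begin

class complex_normed_vector = real_normed_vector +
  fixes scaleC :: "complex \<Rightarrow> 'a \<Rightarrow> 'a"  (infixr \<open>*\<^sub>C\<close> 75)
  assumes scaleC_add_right: "a *\<^sub>C (x + y) = a *\<^sub>C x + a *\<^sub>C y"
    and scaleC_add_left: "(a + b) *\<^sub>C x = a *\<^sub>C x + b *\<^sub>C x"
    and scaleC_scaleC: "a *\<^sub>C (b *\<^sub>C x) = (a * b) *\<^sub>C x"
    and scaleC_one: "1 *\<^sub>C x = x"
    and scaleR_scaleC: "r *\<^sub>R x = complex_of_real r *\<^sub>C x"
    and norm_scaleC: "norm (a *\<^sub>C x) = cmod a * norm x"

class complex_banach = complex_normed_vector + complete_space

subclass (in complex_banach) banach ..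

interpretation complex_vector: vector_space "scaleC :: complex \<Rightarrow> 'a \<Rightarrow> 'a::complex_normed_vector"
  by unfold_locales
    (simp_all add: scaleC_add_right scaleC_add_left scaleC_scaleC scaleC_one)

text \<open>The restriction of an operator \<open>T\<close> to an invariant subspace \<open>M\<close> is represented by
  the same function \<open>T\<close> together with the carrier \<open>M\<close>. The values of \<open>T\<close> outside \<open>M\<close> are
  irrelevant for the notions indexed by \<open>M\<close>.\<close>

definition bounded_operator_on ::
    "'a::complex_normed_vector set \<Rightarrow> ('a \<Rightarrow> 'a) \<Rightarrow> bool" where
  "bounded_operator_on M T \<longleftrightarrow>
     T ` M \<subseteq> M \<and>
     (\<forall>x\<in>M. \<forall>y\<in>M. T (x + y) = T x + T y) \<and>
     (\<forall>c. \<forall>x\<in>M. T (c *\<^sub>C x) = c *\<^sub>C T x) \<and>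
     (\<exists>K. \<forall>x\<in>M. norm (T x) \<le> K * norm x)"

definition invertible_on ::
    "'a::complex_normed_vector set \<Rightarrow> ('a \<Rightarrow> 'a) \<Rightarrow> bool" where
  "invertible_on M T \<longleftrightarrow>
     (\<exists>S. bounded_operator_on M S \<and> (\<forall>x\<in>M. S (T x) = x \<and> T (S x) = x))"

definition spectrum_on ::
    "'a::complex_normed_vector set \<Rightarrow> ('a \<Rightarrow> 'a) \<Rightarrow> complex set" where
  "spectrum_on M T = {\<mu>. \<not> invertible_on M (\<lambda>x. T x - \<mu> *\<^sub>C x)}"

abbreviation spectrum :: "('a::complex_normed_vector \<Rightarrow> 'a) \<Rightarrow> complex set" where
  "spectrum \<equiv> spectrum_on UNIV"

definition acc :: "complex set \<Rightarrow> complex set" where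
  "acc A = {z. z islimpt A}"

definition zeroloid_on ::
    "'a::complex_normed_vector set \<Rightarrow> ('a \<Rightarrow> 'a) \<Rightarrow> bool" where
  "zeroloid_on M T \<longleftrightarrow> acc (spectrum_on M T) \<subseteq> {0}"

definition bounded_below_on ::
    "'a::complex_normed_vector set \<Rightarrow> ('a \<Rightarrow> 'a) \<Rightarrow> bool" where
  "bounded_below_on M T \<longleftrightarrow> (\<exists>c>0. \<forall>x\<in>M. c * norm x \<le> norm (T x))"

definition surjective_on ::
    "'a::complex_normed_vector set \<Rightarrow> ('a \<Rightarrow> 'a) \<Rightarrow> bool" where
  "surjective_on M T \<longleftrightarrow> T ` M = M"

definition closed_invariant_subspace ::
    "('a::complex_normed_vector \<Rightarrow> 'a) \<Rightarrow> 'a set \<Rightarrow> bool" where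
  "closed_invariant_subspace T M \<longleftrightarrow> complex_vector.subspace M \<and> closed M \<and> T ` M \<subseteq> M"

definition Red ::
    "('a::complex_normed_vector \<Rightarrow> 'a) \<Rightarrow> ('a set \<times> 'a set) set" where
  "Red T = {(M, N). closed_invariant_subspace T M \<and> closed_invariant_subspace T N \<and>
     M \<inter> N = {0} \<and> (\<forall>x. \<exists>m\<in>M. \<exists>n\<in>N. x = m + n)}"

definition left_gz_invertible :: "('a::complex_normed_vector \<Rightarrow> 'a) \<Rightarrow> bool" where
  "left_gz_invertible T \<longleftrightarrow> (\<exists>(M, N)\<in>Red T. bounded_below_on M T \<and> zeroloid_on N T)"

definition right_gz_invertible :: "('a::complex_normed_vector \<Rightarrow> 'a) \<Rightarrow> bool" where
  "right_gz_invertible T \<longleftrightarrow> (\<exists>(M, N)\<in>Red T. surjective_on M T \<and> zeroloid_on N T)"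

definition gz_invertible :: "('a::complex_normed_vector \<Rightarrow> 'a) \<Rightarrow> bool" where
  "gz_invertible T \<longleftrightarrow> left_gz_invertible T \<and> right_gz_invertible T"

definition gzd_spectrum :: "('a::complex_normed_vector \<Rightarrow> 'a) \<Rightarrow> complex set" where
  "gzd_spectrum T = {\<mu>. \<not> gz_invertible (\<lambda>x. T x - \<mu> *\<^sub>C x)}"

end

theory Submission
  imports Defs
begin

text \<open>After replacing \<open>T\<close> by \<open>T - \<mu>\<close> it is enough to show that \<open>T\<close> is \<open>g\<^sub>z\<close>-invertible if and only
if \<open>0\<close> is not an accumulation point of \<open>acc \<sigma>(T)\<close>. By the open mapping theorem a bounded operator
on a closed subspace is invertible exactly when it is bijective, so throughout the spectrum of a
restriction is handled through bijectivity alone.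

If \<open>T\<close> is \<open>g\<^sub>z\<close>-invertible, there are a decomposition \<open>M \<oplus> N\<close> with \<open>T\<close> bounded below on \<open>M\<close> and a
possibly different one, \<open>M' \<oplus> N'\<close>, with \<open>T\<close> surjective on \<open>M'\<close>. Both properties survive small
shifts. Hence for small \<open>\<mu>\<close> outside \<open>\<sigma>(T\<^sub>N)\<close> the operator \<open>T - \<mu>\<close> is injective, and for small \<open>\<mu>\<close>
outside \<open>\<sigma>(T\<^sub>N\<^sub>')\<close> it is surjective. So near \<open>0\<close> the spectrum of \<open>T\<close> lies in the union of the two
spectra \<open>\<sigma>(T\<^sub>N)\<close> and \<open>\<sigma>(T\<^sub>N\<^sub>')\<close>, which accumulate at most at \<open>0\<close>. The two decompositions
may be unrelated.

Conversely, if \<open>0\<close> is not an accumulation point of \<open>acc \<sigma>(T)\<close>, then only finitely many spectral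
points lie in a suitable annulus around \<open>0\<close>, so some circle \<open>\<bar>z\<bar> = r\<close> avoids \<open>\<sigma>(T)\<close>, and the Riesz
projection of that circle splits \<open>X\<close> into \<open>M\<close>, on which \<open>T\<close> is invertible, and \<open>N\<close>, on which the
spectrum of \<open>T\<close> is contained in \<open>\<sigma>(T) \<inter> {z. \<bar>z\<bar> < r}\<close> and accumulates at most at \<open>0\<close>.

The Riesz projection is obtained without contour integrals. Put \<open>A = T / r\<close>. The average
of \<open>1/(1 - c A)\<close> over the \<open>n\<close>-th roots of unity \<open>c\<close> is \<open>1/(1 - A\<^sup>n)\<close>, and for \<open>n = 2\<^sup>j\<close> passing
from \<open>j\<close> to \<open>j + 1\<close> only uses \<open>1/(1 - w\<^sup>2) = (1/(1 - w) + 1/(1 + w)) / 2\<close>. Because the resolvent is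
Lipschitz on the circle, these operators form a Cauchy sequence (\<open>Riesz_projection\<close>); the identity
\<open>1/(1 - w\<^sup>2) = 1/(1 - w) \<cdot> 1/(1 + w)\<close> makes the limit idempotent. On the kernel of the limit
\<open>1/(1 - A\<^sup>n)\<close> is eventually small, which forces \<open>A\<^sup>n\<close> and hence \<open>A\<close> to be invertible there; on its
range \<open>1/(1 - A\<^sup>n)\<close> is eventually close to \<open>1\<close>, which makes \<open>A\<^sup>n\<close> a contraction and keeps the spectrum
inside the open unit disc (\<open>Riesz_splitting\<close>).\<close>

section \<open>Bounded operators on subspaces\<close>

lemma bounded_operator_onD:
  assumes "bounded_operator_on M T"
  shows bounded_operator_on_mem: "x \<in> M \<Longrightarrow> T x \<in> M"
    and bounded_operator_on_add: "x \<in> M \<Longrightarrow> y \<in> M \<Longrightarrow> T (x + y) = T x + T y"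
    and bounded_operator_on_scaleC: "x \<in> M \<Longrightarrow> T (c *\<^sub>C x) = c *\<^sub>C T x"
  using assms by (auto simp: bounded_operator_on_def)

lemma bounded_operator_on_bound:
  assumes "bounded_operator_on M T"
  obtains K where "K > 0" "\<And>x. x \<in> M \<Longrightarrow> norm (T x) \<le> K * norm x"
proof -
  obtain K where K: "\<forall>x\<in>M. norm (T x) \<le> K * norm x"
    using assms by (auto simp: bounded_operator_on_def)
  have "norm (T x) \<le> (\<bar>K\<bar> + 1) * norm x" if "x \<in> M" for x
  proof -
    have "norm (T x) \<le> K * norm x" using K that by blast
    also have "\<dots> \<le> (\<bar>K\<bar> + 1) * norm x" by (intro mult_right_mono) auto
    finally show ?thesis .
  qed
  then show ?thesis by (intro that[of "\<bar>K\<bar> + 1"]) auto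
qed

lemma bounded_operator_on_diff:
  assumes T: "bounded_operator_on M T" and M: "complex_vector.subspace M"
    and "x \<in> M" "y \<in> M"
  shows "T (x - y) = T x - T y"
proof -
  have "T x = T (x - y + y)" by simp
  also have "\<dots> = T (x - y) + T y"
    using assms complex_vector.subspace_diff[OF M] by (intro bounded_operator_on_add[OF T]) auto
  finally show ?thesis by simp
qed

lemma bounded_operator_on_zero:
  assumes "bounded_operator_on M T" "complex_vector.subspace M"
  shows "T 0 = 0"
  using bounded_operator_on_diff[OF assms, of 0 0] complex_vector.subspace_0[OF assms(2)] by simp

lemma bounded_operator_on_restrict:
  assumes "bounded_operator_on UNIV T" "T ` M \<subseteq> M"
  shows "bounded_operator_on M T"
  using assms unfolding bounded_operator_on_def by blast

lemma bounded_operator_on_combination: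
  assumes S: "bounded_operator_on M S" and T: "bounded_operator_on M T"
    and M: "complex_vector.subspace M"
  shows "bounded_operator_on M (\<lambda>x. a *\<^sub>C S x + b *\<^sub>C T x)"
proof -
  obtain K where K: "\<And>x. x \<in> M \<Longrightarrow> norm (S x) \<le> K * norm x"
    using bounded_operator_on_bound[OF S] by blast
  obtain L where L: "\<And>x. x \<in> M \<Longrightarrow> norm (T x) \<le> L * norm x"
    using bounded_operator_on_bound[OF T] by blast
  have "norm (a *\<^sub>C S x + b *\<^sub>C T x) \<le> (cmod a * K + cmod b * L) * norm x" if "x \<in> M" for x
  proof -
    have "norm (a *\<^sub>C S x + b *\<^sub>C T x) \<le> cmod a * norm (S x) + cmod b * norm (T x)"
      by (metis norm_scaleC norm_triangle_ineq)
    also have "\<dots> \<le> cmod a * (K * norm x) + cmod b * (L * norm x)"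
      by (intro add_mono mult_left_mono K L that) auto
    finally show ?thesis by (simp add: algebra_simps)
  qed
  then have "\<exists>C. \<forall>x\<in>M. norm (a *\<^sub>C S x + b *\<^sub>C T x) \<le> C * norm x" by blast
  moreover have "a *\<^sub>C S x + b *\<^sub>C T x \<in> M" if "x \<in> M" for x
    by (intro complex_vector.subspace_add[OF M] complex_vector.subspace_scale[OF M]
        bounded_operator_on_mem[OF S] bounded_operator_on_mem[OF T] that)
  ultimately show ?thesis
    unfolding bounded_operator_on_def
    by (auto simp: bounded_operator_on_add[OF S] bounded_operator_on_add[OF T]
        bounded_operator_on_scaleC[OF S] bounded_operator_on_scaleC[OF T]
        scaleC_add_right scaleC_scaleC mult.commute)
qed

lemma bounded_operator_on_id: "bounded_operator_on M (\<lambda>x. x)"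
  unfolding bounded_operator_on_def by (auto intro: exI[of _ 1])

lemma bounded_operator_on_compose:
  assumes S: "bounded_operator_on M S" and T: "bounded_operator_on M T"
  shows "bounded_operator_on M (\<lambda>x. S (T x))"
proof -
  obtain K where K: "K > 0" "\<And>x. x \<in> M \<Longrightarrow> norm (S x) \<le> K * norm x"
    using bounded_operator_on_bound[OF S] by blast
  obtain L where L: "\<And>x. x \<in> M \<Longrightarrow> norm (T x) \<le> L * norm x"
    using bounded_operator_on_bound[OF T] by blast
  have "norm (S (T x)) \<le> (K * L) * norm x" if "x \<in> M" for x
  proof -
    have "norm (S (T x)) \<le> K * norm (T x)" by (intro K bounded_operator_on_mem[OF T] that)
    also have "\<dots> \<le> K * (L * norm x)" using K(1) L[OF that] by (intro mult_left_mono) auto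
    finally show ?thesis by (simp add: algebra_simps)
  qed
  then have "\<exists>C. \<forall>x\<in>M. norm (S (T x)) \<le> C * norm x" by blast
  then show ?thesis
    unfolding bounded_operator_on_def
    by (auto simp: bounded_operator_on_add[OF S] bounded_operator_on_add[OF T]
        bounded_operator_on_scaleC[OF S] bounded_operator_on_scaleC[OF T]
        bounded_operator_on_mem[OF S] bounded_operator_on_mem[OF T])
qed

lemma bounded_operator_on_shift:
  assumes "bounded_operator_on M T" "complex_vector.subspace M"
  shows "bounded_operator_on M (\<lambda>x. T x - \<mu> *\<^sub>C x)"
  using bounded_operator_on_combination[OF assms(1) bounded_operator_on_id assms(2), of 1 "- \<mu>"]
  by (simp add: scaleC_one)

lemma bounded_operator_on_one_minus:
  assumes "bounded_operator_on M T" "complex_vector.subspace M"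
  shows "bounded_operator_on M (\<lambda>x. x - c *\<^sub>C T x)"
  using bounded_operator_on_combination[OF bounded_operator_on_id assms, of 1 "- c"]
  by (simp add: scaleC_one)

lemma bounded_operator_on_tendsto:
  assumes T: "bounded_operator_on M T" and M: "complex_vector.subspace M"
    and lim: "f \<longlonglongrightarrow> x" and "\<And>n. f n \<in> M" "x \<in> M"
  shows "(\<lambda>n. T (f n)) \<longlonglongrightarrow> T x"
proof -
  obtain K where K: "K > 0" "\<And>x. x \<in> M \<Longrightarrow> norm (T x) \<le> K * norm x"
    using bounded_operator_on_bound[OF T] by blast
  have "norm (T (f n) - T x) \<le> norm (f n - x) * K" for n
    using K(2)[of "f n - x"] assms(4,5) complex_vector.subspace_diff[OF M]
    by (simp add: bounded_operator_on_diff[OF T M] mult.commute)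
  moreover have "(\<lambda>n. norm (f n - x) * K) \<longlonglongrightarrow> 0"
    using tendsto_mult_left_zero[OF tendsto_norm_zero[OF LIM_zero[OF lim]]] .
  ultimately have "(\<lambda>n. T (f n) - T x) \<longlonglongrightarrow> 0"
    by (rule Lim_null_comparison[OF always_eventually[OF allI]])
  then show ?thesis by (rule LIM_zero_cancel)
qed

text \<open>Solving \<open>T x = y\<close> up to an error \<open>q \<parallel>y\<parallel>\<close>, then solving for the error, and so on, gives a
geometrically convergent series of corrections. The approximate solution may depend on \<open>y\<close> in a
nonlinear way, so one argument serves the open mapping theorem, the Neumann series and the
stability of surjectivity.\<close>

lemma successive_approximation:
  fixes M :: "'a::complex_banach set"
  assumes M: "complex_vector.subspace M" "closed M" and T: "bounded_operator_on M T"
    and q: "0 \<le> q" "q < 1"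
    and approx: "\<And>y. y \<in> M \<Longrightarrow> \<exists>x\<in>M. norm x \<le> K * norm y \<and> norm (y - T x) \<le> q * norm y"
    and y: "y \<in> M"
  shows "\<exists>x\<in>M. T x = y \<and> norm x \<le> K / (1 - q) * norm y"
proof -
  obtain s where s: "\<And>y. y \<in> M \<Longrightarrow> s y \<in> M" "\<And>y. y \<in> M \<Longrightarrow> norm (s y) \<le> K * norm y"
    "\<And>y. y \<in> M \<Longrightarrow> norm (y - T (s y)) \<le> q * norm y"
    using approx by metis
  define r where "r k = ((\<lambda>y. y - T (s y)) ^^ k) y" for k
  have r_Suc: "r (Suc k) = r k - T (s (r k))" for k by (simp add: r_def)
  have r_0: "r 0 = y" by (simp add: r_def)
  have r_mem: "r k \<in> M" for k
    by (induction k) (auto simp: r_0 y r_Suc intro!: complex_vector.subspace_diff[OF M(1)]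
        bounded_operator_on_mem[OF T] s)
  have r_norm: "norm (r k) \<le> q ^ k * norm y" for k
  proof (induction k)
    case (Suc k)
    have "norm (r (Suc k)) \<le> q * norm (r k)" unfolding r_Suc by (intro s r_mem)
    also have "\<dots> \<le> q * (q ^ k * norm y)" using Suc q by (intro mult_left_mono) auto
    finally show ?case by (simp add: mult_ac)
  qed (simp add: r_0)
  \<comment> \<open>\<open>K\<close> may be negative when \<open>M\<close> is trivial, hence the case distinction.\<close>
  have K: "norm (s (r k)) \<le> K * norm y * q ^ k" for k
  proof (cases "norm (r k) = 0")
    case True
    then have "norm (s (r k)) \<le> 0" using s(2)[OF r_mem[of k]] by simp
    moreover have "0 \<le> K * norm y"
      using s(2)[OF y] norm_ge_zero order_trans by blast
    ultimately show ?thesis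
      using q by (intro order_trans[OF _ mult_nonneg_nonneg[of _ "q ^ k"]]) auto
  next
    case False
    have "0 \<le> K * norm (r k)"
      using s(2)[OF r_mem[of k]] norm_ge_zero order_trans by blast
    then have "0 \<le> K" using False by (simp add: zero_le_mult_iff)
    then have "K * norm (r k) \<le> K * (q ^ k * norm y)" by (intro mult_left_mono r_norm)
    then show ?thesis using s(2)[OF r_mem[of k]] by (simp add: mult_ac)
  qed
  have geo: "(\<lambda>k. K * norm y * q ^ k) sums (K * norm y * (1 / (1 - q)))"
    using q by (intro sums_mult geometric_sums) auto
  have summ: "summable (\<lambda>k. norm (s (r k)))"
    by (rule summable_comparison_test'[where g="\<lambda>k. K * norm y * q ^ k" and N=0])
      (use geo K in \<open>auto simp: sums_iff\<close>)
  define x where "x = (\<Sum>k. s (r k))"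
  have part_lim: "(\<lambda>n. \<Sum>k<n. s (r k)) \<longlonglongrightarrow> x"
    unfolding x_def by (rule summable_LIMSEQ[OF summable_norm_cancel[OF summ]])
  have part_mem: "(\<Sum>k<n. s (r k)) \<in> M" for n
    by (intro complex_vector.subspace_sum[OF M(1)] s r_mem)
  have x_mem: "x \<in> M"
    using closed_sequentially[OF M(2) _ part_lim] part_mem by blast
  have "T (\<Sum>k<n. s (r k)) = y - r n" for n
  proof (induction n)
    case 0 then show ?case by (simp add: r_0 bounded_operator_on_zero[OF T M(1)])
  next
    case (Suc n)
    have "T (\<Sum>k<Suc n. s (r k)) = T (\<Sum>k<n. s (r k)) + T (s (r n))"
      using part_mem s(1)[OF r_mem] by (simp add: bounded_operator_on_add[OF T])
    then show ?case by (simp add: Suc r_Suc)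
  qed
  moreover have "(\<lambda>n. T (\<Sum>k<n. s (r k))) \<longlonglongrightarrow> T x"
    by (rule bounded_operator_on_tendsto[OF T M(1) part_lim part_mem x_mem])
  moreover have "r \<longlonglongrightarrow> 0"
  proof (rule Lim_null_comparison[OF always_eventually])
    show "\<forall>k. norm (r k) \<le> q ^ k * norm y" using r_norm by blast
    show "(\<lambda>k. q ^ k * norm y) \<longlonglongrightarrow> 0"
      using q by (intro tendsto_mult_left_zero LIMSEQ_power_zero) auto
  qed
  then have "(\<lambda>n. y - r n) \<longlonglongrightarrow> y - 0" by (intro tendsto_intros)
  ultimately have "T x = y" using LIMSEQ_unique by fastforce
  moreover have "norm x \<le> K / (1 - q) * norm y"
  proof -
    have "norm x \<le> (\<Sum>k. norm (s (r k)))" unfolding x_def by (rule summable_norm[OF summ])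
    also have "\<dots> \<le> (\<Sum>k. K * norm y * q ^ k)"
      using geo by (intro suminf_le K summ) (auto simp: sums_iff)
    also have "\<dots> = K / (1 - q) * norm y" using geo by (auto simp: sums_iff)
    finally show ?thesis .
  qed
  ultimately show ?thesis using x_mem by blast
qed

section \<open>Open mapping theorem and bijectivity\<close>

text \<open>Banach's theorem: by the Baire category theorem the closure of the image of some ball contains a
ball around a point \<open>y0\<close>; taking differences moves the centre to \<open>0\<close>, and successive approximation
removes the closure.\<close>

lemma open_mapping_on:
  fixes M :: "'a::complex_banach set"
  assumes M: "complex_vector.subspace M" "closed M" and T: "bounded_operator_on M T"
    and surj: "T ` M = M"
  obtains K where "K > 0" "\<And>y. y \<in> M \<Longrightarrow> \<exists>x\<in>M. T x = y \<and> norm x \<le> K * norm y"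
proof -
  define E where "E n = closure (T ` (M \<inter> cball 0 (real n)))" for n
  have E_sub: "E n \<subseteq> M" for n
    unfolding E_def using surj M(2) by (intro closure_minimal) auto
  have cover: "\<Union> (range E) = M"
  proof
    show "M \<subseteq> \<Union> (range E)"
    proof
      fix y assume "y \<in> M"
      then obtain x where x: "x \<in> M" "y = T x" using surj by blast
      obtain n where "norm x \<le> real n" using real_arch_simple by blast
      then have "y \<in> E n" unfolding E_def
        using x by (intro subsetD[OF closure_subset]) auto
      then show "y \<in> \<Union> (range E)" by blast
    qed
  qed (use E_sub in blast)
  have "\<exists>n. top_of_set M interior_of (E n) \<noteq> {}"
  proof (rule ccontr)
    assume *: "\<not> ?thesis"
    have "top_of_set M interior_of \<Union> (range E) = {}"
    proof (rule Baire_category_alt)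
      show "completely_metrizable_space (top_of_set M) \<or>
          locally_compact_space (top_of_set M) \<and> regular_space (top_of_set M)"
        using M(2) 
        using closed_closedin completely_metrizable_space_closedin completely_metrizable_space_euclidean by blast
      fix F assume "F \<in> range E"
      then obtain n where n: "F = E n" by blast
      have "closedin (top_of_set M) (E n)"
        using E_sub[of n] by (simp add: E_def closed_subset)
      then show "closedin (top_of_set M) F \<and> top_of_set M interior_of F = {}"
        using * n by auto
    qed auto
    moreover have "top_of_set M interior_of M = M"
      by (simp add: interior_of_openin)
    ultimately show False using cover complex_vector.subspace_0[OF M(1)] by auto
  qed
  then obtain n U y0 where U: "openin (top_of_set M) U" "U \<subseteq> E n" "y0 \<in> U"
    by (auto simp: interior_of_def)
  then obtain e where e: "e > 0" "\<And>y. y \<in> M \<Longrightarrow> dist y y0 < e \<Longrightarrow> y \<in> E n" and y0: "y0 \<in> M"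
    by (meson openin_euclidean_subtopology_iff subsetD)
  have near: "\<exists>x\<in>M. norm x \<le> real n \<and> norm (T x - y) < e / 8" if "y \<in> M" "dist y y0 < e" for y
  proof -
    have "y \<in> E n" using e that by blast
    then obtain z where "z \<in> T ` (M \<inter> cball 0 (real n))" "dist z y < e / 8"
      unfolding E_def closure_approachable using e(1) by (metis zero_less_divide_iff zero_less_numeral)
    then show ?thesis by (auto simp: dist_norm)
  qed
  have approx: "\<exists>x\<in>M. norm x \<le> (4 * (real n + 1) / e) * norm y \<and> norm (y - T x) \<le> 1/2 * norm y"
    if y: "y \<in> M" for y
  proof (cases "y = 0")
    case True
    then show ?thesis
      using complex_vector.subspace_0[OF M(1)] bounded_operator_on_zero[OF T M(1)]
      by (intro bexI[of _ 0]) auto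
  next
    case False
    \<comment> \<open>Rescale \<open>y\<close> to norm \<open>e / 2\<close>, so that \<open>y0\<close> and \<open>y0 + t y\<close> both lie in the ball.\<close>
    define t where "t = e / (2 * norm y)"
    have t: "t > 0" using e(1) False by (simp add: t_def)
    have ty: "norm (t *\<^sub>R y) = e / 2" using False e(1) by (simp add: t_def)
    have real_mem: "c *\<^sub>R x \<in> M" if "x \<in> M" for c x
      using complex_vector.subspace_scale[OF M(1) that] by (simp add: scaleR_scaleC)
    have "y0 + t *\<^sub>R y \<in> M" by (intro complex_vector.subspace_add[OF M(1)] real_mem y y0)
    then obtain x1 where x1: "x1 \<in> M" "norm x1 \<le> real n" "norm (T x1 - (y0 + t *\<^sub>R y)) < e / 8"
      using near[of "y0 + t *\<^sub>R y"] ty e(1) by (auto simp: dist_norm)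
    obtain x2 where x2: "x2 \<in> M" "norm x2 \<le> real n" "norm (T x2 - y0) < e / 8"
      using near[of y0] y0 e(1) by auto
    define x where "x = (1 / t) *\<^sub>R (x1 - x2)"
    have d: "x1 - x2 \<in> M" by (intro complex_vector.subspace_diff[OF M(1)] x1 x2)
    have x: "x \<in> M" unfolding x_def by (intro real_mem d)
    have Tx: "T x = (1 / t) *\<^sub>R (T x1 - T x2)"
      unfolding x_def scaleR_scaleC using d x1 x2
      by (simp add: bounded_operator_on_scaleC[OF T] bounded_operator_on_diff[OF T M(1)])
    have "norm x \<le> (1 / t) * (real n + real n)"
      unfolding x_def using t x1 x2 norm_triangle_ineq4[of x1 x2]
      by (simp add: divide_simps)
    also have "\<dots> = 4 * real n / e * norm y" using e(1) False by (simp add: t_def field_simps)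
    also have "\<dots> \<le> (4 * (real n + 1) / e) * norm y"
      using e(1) by (intro mult_right_mono divide_right_mono) auto
    finally have nx: "norm x \<le> (4 * (real n + 1) / e) * norm y" .
    have "y - T x = (1 / t) *\<^sub>R ((T x2 - y0) - (T x1 - (y0 + t *\<^sub>R y)))"
      unfolding Tx using t by (simp add: algebra_simps)
    then have "norm (y - T x) = (1 / t) * norm ((T x2 - y0) - (T x1 - (y0 + t *\<^sub>R y)))"
      using t by simp
    also have "\<dots> \<le> (1 / t) * (e / 8 + e / 8)"
      using t x1 x2 norm_triangle_ineq4[of "T x2 - y0" "T x1 - (y0 + t *\<^sub>R y)"]
      by (intro mult_left_mono) auto
    also have "\<dots> = 1/2 * norm y" using e(1) False by (simp add: t_def field_simps)
    finally show ?thesis using x nx by blast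
  qed
  show ?thesis
  proof (rule that)
    show "(4 * (real n + 1) / e) / (1 - 1/2) > 0" using e(1) by simp
    fix y assume "y \<in> M"
    then show "\<exists>x\<in>M. T x = y \<and> norm x \<le> (4 * (real n + 1) / e) / (1 - 1/2) * norm y"
      by (intro successive_approximation[OF M T _ _ approx]) auto
  qed
qed

lemma invertible_on_iff_bij_betw:
  fixes M :: "'a::complex_banach set"
  assumes M: "complex_vector.subspace M" "closed M" and T: "bounded_operator_on M T"
  shows "invertible_on M T \<longleftrightarrow> bij_betw T M M"
proof
  assume "invertible_on M T"
  then obtain S where S: "bounded_operator_on M S" "\<And>x. x \<in> M \<Longrightarrow> S (T x) = x"
    "\<And>x. x \<in> M \<Longrightarrow> T (S x) = x"
    by (auto simp: invertible_on_def)
  then show "bij_betw T M M"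
    using T by (intro bij_betw_byWitness[where f'=S]) (auto simp: bounded_operator_on_def)
next
  assume bij: "bij_betw T M M"
  then have inj: "inj_on T M" and surj: "T ` M = M" by (auto simp: bij_betw_def)
  define S where "S = inv_into M T"
  have S_mem: "S y \<in> M" if "y \<in> M" for y
    using that surj inv_into_into[of y T M] by (simp add: S_def)
  have TS: "T (S y) = y" if "y \<in> M" for y
    using that surj f_inv_into_f[of y T M] by (simp add: S_def)
  have ST: "S (T x) = x" if "x \<in> M" for x
    using inv_into_f_f[OF inj that] by (simp add: S_def)
  have S_eqI: "S y = x" if "x \<in> M" "T x = y" for x y
    using ST that by blast
  obtain K where K: "K > 0" "\<And>y. y \<in> M \<Longrightarrow> \<exists>x\<in>M. T x = y \<and> norm x \<le> K * norm y"
    using open_mapping_on[OF M T surj] by blast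
  have "norm (S y) \<le> K * norm y" if "y \<in> M" for y
    using K(2)[OF that] S_eqI by auto
  then have "\<exists>K. \<forall>y\<in>M. norm (S y) \<le> K * norm y" by blast
  moreover have "S (x + y) = S x + S y" if "x \<in> M" "y \<in> M" for x y
    by (rule S_eqI)
      (simp_all add: that S_mem TS bounded_operator_on_add[OF T] complex_vector.subspace_add[OF M(1)])
  moreover have "S (c *\<^sub>C x) = c *\<^sub>C S x" if "x \<in> M" for c x
    by (rule S_eqI)
      (simp_all add: that S_mem TS bounded_operator_on_scaleC[OF T] complex_vector.subspace_scale[OF M(1)])
  ultimately have "bounded_operator_on M S"
    unfolding bounded_operator_on_def using S_mem by blast
  then show "invertible_on M T"
    unfolding invertible_on_def using ST TS by blast
qed

lemma spectrum_on_iff_not_bij_betw: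
  fixes M :: "'a::complex_banach set"
  assumes M: "complex_vector.subspace M" "closed M" and T: "bounded_operator_on M T"
  shows "\<mu> \<in> spectrum_on M T \<longleftrightarrow> \<not> bij_betw (\<lambda>x. T x - \<mu> *\<^sub>C x) M M"
  unfolding spectrum_on_def
  using invertible_on_iff_bij_betw[OF M bounded_operator_on_shift[OF T M(1)]] by simp

text \<open>The Neumann series, on a closed invariant subspace.\<close>

lemma bij_betw_one_minus_contraction:
  fixes M :: "'a::complex_banach set"
  assumes M: "complex_vector.subspace M" "closed M" and B: "bounded_operator_on M B"
    and q: "0 \<le> q" "q < 1" and le: "\<And>x. x \<in> M \<Longrightarrow> norm (B x) \<le> q * norm x"
  shows "bij_betw (\<lambda>x. x - B x) M M"
proof -
  have B': "bounded_operator_on M (\<lambda>x. x - B x)"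
    using bounded_operator_on_one_minus[OF B M(1), of 1] by (simp add: scaleC_one)
  have "inj_on (\<lambda>x. x - B x) M"
  proof (rule inj_onI)
    fix x y assume xy: "x \<in> M" "y \<in> M" "x - B x = y - B y"
    have mem: "x - y \<in> M" by (intro complex_vector.subspace_diff[OF M(1)] xy)
    have "x - y = B (x - y)"
      using xy by (simp add: bounded_operator_on_diff[OF B M(1)] algebra_simps)
    then have "norm (x - y) \<le> q * norm (x - y)" using le[OF mem] by simp
    then have "(1 - q) * norm (x - y) \<le> 0" by (simp add: algebra_simps)
    then show "x = y" using q by (simp add: mult_le_0_iff)
  qed
  moreover have "y \<in> (\<lambda>x. x - B x) ` M" if "y \<in> M" for y
  proof -
    have "\<exists>x\<in>M. x - B x = y \<and> norm x \<le> 1 / (1 - q) * norm y"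
    proof (rule successive_approximation[OF M B' q _ that])
      fix z assume "z \<in> M"
      then show "\<exists>x\<in>M. norm x \<le> 1 * norm z \<and> norm (z - (x - B x)) \<le> q * norm z"
        using le by (intro bexI[of _ z]) auto
    qed
    then show ?thesis by blast
  qed
  ultimately show ?thesis
    using bounded_operator_on_mem[OF B'] by (auto simp: bij_betw_def)
qed

section \<open>Small shifts of the operator\<close>

text \<open>A right inverse \<open>s\<close> of \<open>T\<close> with \<open>\<parallel>s y\<parallel> \<le> K \<parallel>y\<parallel>\<close> solves \<open>T x - \<mu> x = y\<close> up to the error \<open>\<mu> s y\<close>,
which is a contraction of \<open>y\<close> as long as \<open>\<bar>\<mu>\<bar> K < 1\<close>.\<close>

lemma surjective_on_stable:
  fixes M :: "'a::complex_banach set"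
  assumes M: "complex_vector.subspace M" "closed M" and T: "bounded_operator_on M T"
    and surj: "surjective_on M T"
  obtains \<epsilon> where "\<epsilon> > 0" "\<And>\<mu>. cmod \<mu> < \<epsilon> \<Longrightarrow> surjective_on M (\<lambda>x. T x - \<mu> *\<^sub>C x)"
proof -
  obtain K where K: "K > 0" "\<And>y. y \<in> M \<Longrightarrow> \<exists>x\<in>M. T x = y \<and> norm x \<le> K * norm y"
    using open_mapping_on[OF M T] surj by (auto simp: surjective_on_def)
  show ?thesis
  proof (rule that)
    show "1 / K > 0" using K by simp
    fix \<mu> assume mu: "cmod \<mu> < 1 / K"
    have T': "bounded_operator_on M (\<lambda>x. T x - \<mu> *\<^sub>C x)"
      by (rule bounded_operator_on_shift[OF T M(1)])
    have "y \<in> (\<lambda>x. T x - \<mu> *\<^sub>C x) ` M" if y: "y \<in> M" for y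
    proof -
      have "\<exists>x\<in>M. T x - \<mu> *\<^sub>C x = y \<and> norm x \<le> K / (1 - cmod \<mu> * K) * norm y"
      proof (rule successive_approximation[OF M T' _ _ _ y])
        show "0 \<le> cmod \<mu> * K" "cmod \<mu> * K < 1" using K mu by (auto simp: field_simps)
        fix z assume "z \<in> M"
        then obtain x where x: "x \<in> M" "T x = z" "norm x \<le> K * norm z" using K by blast
        then have "norm (z - (T x - \<mu> *\<^sub>C x)) \<le> cmod \<mu> * K * norm z"
          by (simp add: norm_scaleC mult.assoc mult_left_mono)
        then show "\<exists>x\<in>M. norm x \<le> K * norm z \<and> norm (z - (T x - \<mu> *\<^sub>C x)) \<le> cmod \<mu> * K * norm z"
          using x by blast
      qed
      then show ?thesis by blast
    qed
    then show "surjective_on M (\<lambda>x. T x - \<mu> *\<^sub>C x)"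
      using bounded_operator_on_mem[OF T'] by (auto simp: surjective_on_def)
  qed
qed

lemma bounded_below_on_stable:
  assumes M: "complex_vector.subspace M" and T: "bounded_operator_on M T"
    and "bounded_below_on M T"
  obtains \<epsilon> where "\<epsilon> > 0" "\<And>\<mu>. cmod \<mu> < \<epsilon> \<Longrightarrow> inj_on (\<lambda>x. T x - \<mu> *\<^sub>C x) M"
proof -
  obtain c where c: "c > 0" "\<And>x. x \<in> M \<Longrightarrow> c * norm x \<le> norm (T x)"
    using assms(3) by (auto simp: bounded_below_on_def)
  have "inj_on (\<lambda>x. T x - \<mu> *\<^sub>C x) M" if mu: "cmod \<mu> < c" for \<mu>
  proof (rule inj_onI)
    fix x y assume xy: "x \<in> M" "y \<in> M" "T x - \<mu> *\<^sub>C x = T y - \<mu> *\<^sub>C y"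
    have "T (x - y) = \<mu> *\<^sub>C (x - y)"
      using xy by (simp add: bounded_operator_on_diff[OF T M]
          complex_vector.scale_right_diff_distrib algebra_simps)
    then have "c * norm (x - y) \<le> cmod \<mu> * norm (x - y)"
      using c(2)[of "x - y"] complex_vector.subspace_diff[OF M] xy by (simp add: norm_scaleC)
    then have "(c - cmod \<mu>) * norm (x - y) \<le> 0" by (simp add: algebra_simps)
    then show "x = y" using mu by (simp add: mult_le_0_iff)
  qed
  then show ?thesis using that c(1) by blast
qed

section \<open>Reducing decompositions\<close>

lemma RedD:
  assumes "(M, N) \<in> Red T"
  shows "complex_vector.subspace M" "closed M" "T ` M \<subseteq> M"
    "complex_vector.subspace N" "closed N" "T ` N \<subseteq> N" "M \<inter> N = {0}"
    "\<And>x. \<exists>m\<in>M. \<exists>n\<in>N. x = m + n"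
  using assms by (auto simp: Red_def closed_invariant_subspace_def)

lemma Red_shift:
  assumes "(M, N) \<in> Red T"
  shows "(M, N) \<in> Red (\<lambda>x. T x - \<mu> *\<^sub>C x)"
  using assms unfolding Red_def closed_invariant_subspace_def
  by (auto intro!: complex_vector.subspace_diff complex_vector.subspace_scale)

lemma Red_injI:
  assumes red: "(M, N) \<in> Red T" and T: "bounded_operator_on UNIV T"
    and inj: "inj_on T M" "inj_on T N"
  shows "inj T"
proof (rule injI)
  fix x y assume "T x = T y"
  obtain m n where mn: "m \<in> M" "n \<in> N" "x - y = m + n" using RedD(8)[OF red] by blast
  have "T m + T n = T (x - y)" unfolding mn(3) by (simp add: bounded_operator_on_add[OF T])
  also have "\<dots> = 0"
    using \<open>T x = T y\<close> by (simp add: bounded_operator_on_diff[OF T])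
  finally have "T m = - T n" by (rule eq_neg_iff_add_eq_0[THEN iffD2])
  moreover have "T (- n) = - T n"
    using bounded_operator_on_diff[OF T, of 0 n] bounded_operator_on_zero[OF T] by simp
  ultimately have "T m = T (- n)" by simp
  moreover have "T (- n) \<in> N" "T m \<in> M"
    using RedD(3,6)[OF red] mn complex_vector.subspace_neg[OF RedD(4)[OF red], of n] by auto
  ultimately have "T m \<in> M \<inter> N" "T (- n) \<in> M \<inter> N" by auto
  then have "T m = T 0" "T (- n) = T 0"
    using RedD(7)[OF red] bounded_operator_on_zero[OF T] by auto
  then have "m = 0" "- n = 0"
    using inj_onD[OF inj(1)] inj_onD[OF inj(2)] mn complex_vector.subspace_0[OF RedD(1)[OF red]]
      complex_vector.subspace_0[OF RedD(4)[OF red]] complex_vector.subspace_neg[OF RedD(4)[OF red]]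
    by blast+
  then show "x = y" using mn(3) by simp
qed

lemma Red_surjI:
  assumes red: "(M, N) \<in> Red T" and T: "bounded_operator_on UNIV T"
    and surj: "T ` M = M" "T ` N = N"
  shows "surj T"
proof -
  have "\<exists>x. y = T x" for y
  proof -
    obtain m n where mn: "m \<in> M" "n \<in> N" "y = m + n" using RedD(8)[OF red] by blast
    then obtain m' n' where "m = T m'" "n = T n'" using surj by blast
    then have "y = T (m' + n')" using mn by (simp add: bounded_operator_on_add[OF T])
    then show ?thesis by blast
  qed
  then show ?thesis unfolding surj_def by blast
qed

lemma Red_sym: "(M, N) \<in> Red T \<Longrightarrow> (N, M) \<in> Red T"
  unfolding Red_def by (auto simp: Int_commute) (metis add.commute)

text \<open>If \<open>y \<in> N\<close> is \<open>T (m + n)\<close>, then \<open>T m = y - T n\<close> lies in \<open>M \<inter> N = {0}\<close>, so injectivity of \<open>T\<close> on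
the whole space puts the preimage \<open>m + n\<close> into \<open>N\<close>.\<close>

lemma Red_bij_betw:
  assumes red: "(M, N) \<in> Red T" and T: "bounded_operator_on UNIV T" and bij: "bij T"
  shows "bij_betw T M M" "bij_betw T N N"
proof -
  have *: "bij_betw T N N" if red: "(M, N) \<in> Red T" for M N
  proof -
    have "y \<in> T ` N" if y: "y \<in> N" for y
    proof -
      obtain x where x: "y = T x" using bij_is_surj[OF bij] by blast
      obtain m n where mn: "m \<in> M" "n \<in> N" "x = m + n" using RedD(8)[OF red] by blast
      have "T m = y - T n" unfolding x mn by (simp add: bounded_operator_on_add[OF T])
      moreover have "T n \<in> N" "T m \<in> M" using RedD(3,6)[OF red] mn by auto
      ultimately have "T m \<in> M \<inter> N"
        using complex_vector.subspace_diff[OF RedD(4)[OF red] y, of "T n"] by simp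
      then have "T m = T 0" using RedD(7)[OF red] bounded_operator_on_zero[OF T] by simp
      then have "m = 0" using injD[OF bij_is_inj[OF bij]] by blast
      then show ?thesis using x mn by simp
    qed
    then show ?thesis
      using RedD(6)[OF red] bij by (auto simp: bij_betw_def intro: inj_on_subset)
  qed
  show "bij_betw T M M" "bij_betw T N N" using * red Red_sym by blast+
qed

section \<open>The spectrum of a \<open>g\<^sub>z\<close>-invertible operator near the origin\<close>

lemma islimpt_Int_ball:
  fixes A :: "'b::metric_space set"
  assumes "z islimpt A" "z \<in> ball c d"
  shows "z islimpt (A \<inter> ball c d)"
  unfolding islimpt_def
proof (intro allI impI)
  fix U assume "z \<in> U" "open U"
  then have "z \<in> U \<inter> ball c d" "open (U \<inter> ball c d)" using assms by auto
  then show "\<exists>y\<in>A \<inter> ball c d. y \<in> U \<and> y \<noteq> z" using assms(1) by (metis IntE IntI islimptE)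
qed

text \<open>For small \<open>\<mu>\<close>, the left decomposition controls injectivity and the right one controls surjectivity
of \<open>T - \<mu>\<close>, so a small spectral value of \<open>T\<close> belongs to the spectrum of one of the two zeroloid
parts.\<close>

lemma gz_invertible_imp_not_acc_acc_spectrum:
  fixes T :: "'a::complex_banach \<Rightarrow> 'a"
  assumes T: "bounded_operator_on UNIV T" and gz: "gz_invertible T"
  shows "0 \<notin> acc (acc (spectrum T))"
proof -
  have shift: "bounded_operator_on UNIV (\<lambda>x. T x - \<mu> *\<^sub>C x)" for \<mu>
    by (rule bounded_operator_on_shift[OF T]) simp
  obtain M N where red: "(M, N) \<in> Red T" and below: "bounded_below_on M T" and zN: "zeroloid_on N T"
    using gz by (auto simp: gz_invertible_def left_gz_invertible_def)
  obtain M' N' where red': "(M', N') \<in> Red T" and surj: "surjective_on M' T" and zN': "zeroloid_on N' T"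
    using gz by (auto simp: gz_invertible_def right_gz_invertible_def)
  note restrict = bounded_operator_on_restrict[OF T]
  obtain \<epsilon> where e: "\<epsilon> > 0" "\<And>\<mu>. cmod \<mu> < \<epsilon> \<Longrightarrow> inj_on (\<lambda>x. T x - \<mu> *\<^sub>C x) M"
    using bounded_below_on_stable[OF RedD(1)[OF red] restrict[OF RedD(3)[OF red]] below] by blast
  obtain \<epsilon>' where e': "\<epsilon>' > 0" "\<And>\<mu>. cmod \<mu> < \<epsilon>' \<Longrightarrow> surjective_on M' (\<lambda>x. T x - \<mu> *\<^sub>C x)"
    using surjective_on_stable[OF RedD(1,2)[OF red'] restrict[OF RedD(3)[OF red']] surj] by blast
  define \<delta> where "\<delta> = min \<epsilon> \<epsilon>'"
  have sub: "spectrum T \<inter> ball 0 \<delta> \<subseteq> spectrum_on N T \<union> spectrum_on N' T"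
  proof (rule subsetI, rule ccontr)
    fix \<mu> assume mu: "\<mu> \<in> spectrum T \<inter> ball 0 \<delta>" and "\<mu> \<notin> spectrum_on N T \<union> spectrum_on N' T"
    then have N: "bij_betw (\<lambda>x. T x - \<mu> *\<^sub>C x) N N" and N': "bij_betw (\<lambda>x. T x - \<mu> *\<^sub>C x) N' N'"
      using spectrum_on_iff_not_bij_betw[OF RedD(4,5)[OF red] restrict[OF RedD(6)[OF red]]]
        spectrum_on_iff_not_bij_betw[OF RedD(4,5)[OF red'] restrict[OF RedD(6)[OF red']]] by auto
    have "inj (\<lambda>x. T x - \<mu> *\<^sub>C x)"
      using e(2) mu N by (intro Red_injI[OF Red_shift[OF red] shift]) (auto simp: \<delta>_def bij_betw_def)
    moreover have "surj (\<lambda>x. T x - \<mu> *\<^sub>C x)"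
      using e'(2) mu N'
      by (intro Red_surjI[OF Red_shift[OF red'] shift]) (auto simp: \<delta>_def bij_betw_def surjective_on_def)
    ultimately have "\<mu> \<notin> spectrum T"
      using spectrum_on_iff_not_bij_betw[OF _ _ T] by (simp add: bij_def)
    then show False using mu by blast
  qed
  have "z = 0" if z: "z \<in> acc (spectrum T)" "z \<in> ball 0 \<delta>" for z
  proof -
    have "z islimpt (spectrum T \<inter> ball 0 \<delta>)"
      using z by (intro islimpt_Int_ball) (auto simp: acc_def)
    then have "z islimpt (spectrum_on N T \<union> spectrum_on N' T)" by (rule islimpt_subset[OF _ sub])
    then show ?thesis
      using zN zN' by (auto simp: islimpt_Un zeroloid_on_def acc_def)
  qed
  moreover have "\<delta> > 0" using e(1) e'(1) by (simp add: \<delta>_def)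
  ultimately show ?thesis
    unfolding acc_def islimpt_approachable by (force simp: acc_def)
qed

section \<open>The Riesz projection of a circle\<close>

lemma norm_cis_diff_le: "cmod (cis a - cis b) \<le> \<bar>a - b\<bar>"
proof -
  have "cis a - cis b = cis b * (cis (a - b) - 1)" by (simp add: algebra_simps cis_mult)
  then have "cmod (cis a - cis b) = cmod (exp (\<i> * of_real (a - b)) - 1)"
    by (simp add: norm_mult cis_conv_exp)
  also have "\<dots> = 2 * \<bar>sin ((a - b) / 2)\<bar>" by (rule dist_exp_i_1)
  also have "\<dots> \<le> 2 * \<bar>(a - b) / 2\<bar>" by (intro mult_left_mono abs_sin_le_one abs_sin_x_le_abs_x) auto
  finally show ?thesis by simp
qed

text \<open>The hypothesis \<open>bij_circle\<close> says that the spectrum of \<open>A\<close> misses the unit circle; writing it with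
\<open>1 - c A\<close> instead of \<open>A - z\<close> (where \<open>c = 1/z\<close>) makes the factorisation of \<open>1 - (c A)\<^sup>2\<close> directly
applicable.\<close>

locale circle_avoiding_operator =
  fixes A :: "'a::complex_banach \<Rightarrow> 'a"
  assumes A: "bounded_operator_on UNIV A"
    and bij_circle: "cmod c = 1 \<Longrightarrow> bij (\<lambda>x. x - c *\<^sub>C A x)"
begin

lemmas A_simps = bounded_operator_on_add[OF A] bounded_operator_on_scaleC[OF A]
  bounded_operator_on_diff[OF A] bounded_operator_on_zero[OF A]

lemma one_minus: "bounded_operator_on UNIV (\<lambda>x. x - c *\<^sub>C A x)"
  by (rule bounded_operator_on_one_minus[OF A]) simp

text \<open>This bounds the resolvent uniformly on the circle. Each \<open>1 - c A\<close> is bounded below by the open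
mapping theorem, half of the bound persists for all \<open>d\<close> in a neighbourhood of \<open>c\<close>, and finitely many
such neighbourhoods cover the circle.\<close>

lemma uniform_lower_bound:
  obtains C where "C > 0" "\<And>c x. cmod c = 1 \<Longrightarrow> norm x \<le> C * norm (x - c *\<^sub>C A x)"
proof -
  obtain K where K: "K > 0" "\<And>x. norm (A x) \<le> K * norm x"
    using bounded_operator_on_bound[OF A] by auto
  have "\<exists>C>0. \<forall>x. norm x \<le> C * norm (x - c *\<^sub>C A x)" if "cmod c = 1" for c
  proof -
    note bij = bij_circle[OF that]
    obtain C where C: "C > 0" "\<And>y. \<exists>x. x - c *\<^sub>C A x = y \<and> norm x \<le> C * norm y"
      using open_mapping_on[OF _ _ one_minus[of c]] bij_is_surj[OF bij] by auto
    have "norm x \<le> C * norm (x - c *\<^sub>C A x)" for x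
      using C(2)[of "x - c *\<^sub>C A x"] injD[OF bij_is_inj[OF bij]] by metis
    then show ?thesis using C(1) by blast
  qed
  then obtain C where C: "\<And>c. cmod c = 1 \<Longrightarrow> C c > 0"
    "\<And>c x. cmod c = 1 \<Longrightarrow> norm x \<le> C c * norm (x - c *\<^sub>C A x)" by metis
  \<comment> \<open>With this radius, \<open>C c * norm (x - d *\<^sub>C A x)\<close> varies with \<open>d\<close> by at most \<open>norm x / 2\<close>.\<close>
  define U where "U c = ball c (1 / (2 * K * C c))" for c
  have near: "norm x \<le> 2 * C c * norm (x - d *\<^sub>C A x)" if "cmod c = 1" "d \<in> U c" for c d x
  proof -
    have "x - c *\<^sub>C A x = (x - d *\<^sub>C A x) + (d - c) *\<^sub>C A x"
      by (simp add: complex_vector.scale_left_diff_distrib)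
    then have "norm (x - c *\<^sub>C A x) \<le> norm (x - d *\<^sub>C A x) + cmod (d - c) * norm (A x)"
      by (metis norm_scaleC norm_triangle_ineq)
    also have "\<dots> \<le> norm (x - d *\<^sub>C A x) + 1 / (2 * K * C c) * (K * norm x)"
      using that(2) K C(1)[OF that(1)]
      by (intro add_left_mono mult_mono) (auto simp: U_def dist_norm norm_minus_commute)
    also have "\<dots> = norm (x - d *\<^sub>C A x) + norm x / (2 * C c)" using K(1) by simp
    finally have "C c * norm (x - c *\<^sub>C A x) \<le> C c * (norm (x - d *\<^sub>C A x) + norm x / (2 * C c))"
      using C(1)[OF that(1)] by (intro mult_left_mono) auto
    then have "norm x \<le> C c * norm (x - d *\<^sub>C A x) + norm x / 2"
      using C(2)[OF that(1), of x] C(1)[OF that(1)] by (simp add: distrib_left)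
    then show ?thesis by simp
  qed
  have "sphere 0 1 \<subseteq> (\<Union>c\<in>sphere 0 1. U c)"
    using C(1) K(1) by (force simp: U_def)
  then obtain D where D: "D \<subseteq> sphere 0 1" "finite D" "sphere 0 1 \<subseteq> (\<Union>c\<in>D. U c)"
    using compactE_image[OF compact_sphere, of "sphere 0 1" U 0 1] by (auto simp: U_def)
  define B where "B = (\<Sum>c\<in>D. 2 * C c)"
  have pos: "C c > 0" if "c \<in> D" for c using D(1) C(1) that by auto
  have "norm x \<le> (B + 1) * norm (x - d *\<^sub>C A x)" if d: "cmod d = 1" for d x
  proof -
    obtain c where c: "c \<in> D" "d \<in> U c" using D(3) d by auto
    then have "norm x \<le> 2 * C c * norm (x - d *\<^sub>C A x)" using D(1) by (intro near) auto
    moreover have "2 * C c \<le> B"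
      unfolding B_def using D(2) c(1) pos by (intro member_le_sum) (auto intro: less_imp_le)
    then have "2 * C c * norm (x - d *\<^sub>C A x) \<le> (B + 1) * norm (x - d *\<^sub>C A x)"
      by (intro mult_right_mono) auto
    ultimately show ?thesis by linarith
  qed
  moreover have "B \<ge> 0" unfolding B_def using pos by (intro sum_nonneg) (auto intro: less_imp_le)
  ultimately show ?thesis using that[of "B + 1"] by auto
qed

definition R :: "complex \<Rightarrow> 'a \<Rightarrow> 'a" where
  "R c = inv (\<lambda>x. x - c *\<^sub>C A x)"

lemma one_minus_R: "cmod c = 1 \<Longrightarrow> R c x - c *\<^sub>C A (R c x) = x"
  unfolding R_def using surj_f_inv_f[OF bij_is_surj[OF bij_circle]] by metis

lemma R_one_minus: "cmod c = 1 \<Longrightarrow> R c (x - c *\<^sub>C A x) = x"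
  unfolding R_def using inv_f_f[OF bij_is_inj[OF bij_circle]] by metis

lemma R_bounded_operator:
  assumes "cmod c = 1"
  shows "bounded_operator_on UNIV (R c)"
proof -
  obtain S where S: "bounded_operator_on UNIV S"
    "\<And>x. S (x - c *\<^sub>C A x) = x" "\<And>x. S x - c *\<^sub>C A (S x) = x"
    using invertible_on_iff_bij_betw[OF _ _ one_minus[of c]] bij_circle[OF assms]
    by (auto simp: invertible_on_def)
  have "R c = S"
    using S(2,3) R_one_minus[OF assms] by (metis ext)
  then show ?thesis using S by simp
qed

text \<open>A quantitative form of the resolvent identity: with \<open>u = R c x\<close> and \<open>v = R d x\<close> one has
\<open>(1 - c A) (u - v) = (c - d) A v\<close>.\<close>

lemma R_Lipschitz:
  obtains L where "L > 0" "\<And>s t x. norm (R (cis s) x - R (cis t) x) \<le> L * \<bar>s - t\<bar> * norm x"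
proof -
  obtain C where C: "C > 0" "\<And>c x. cmod c = 1 \<Longrightarrow> norm x \<le> C * norm (x - c *\<^sub>C A x)"
    using uniform_lower_bound by blast
  obtain K where K: "K > 0" "\<And>x. norm (A x) \<le> K * norm x"
    using bounded_operator_on_bound[OF A] by auto
  have "norm (R (cis s) x - R (cis t) x) \<le> (C * K * C) * \<bar>s - t\<bar> * norm x" for s t x
  proof -
    define u v where "u = R (cis s) x" and "v = R (cis t) x"
    have u: "u - cis s *\<^sub>C A u = x" and v: "v - cis t *\<^sub>C A v = x"
      by (simp_all add: u_def v_def one_minus_R)
    have "(u - v) - cis s *\<^sub>C A (u - v) = (u - cis s *\<^sub>C A u) - (v - cis s *\<^sub>C A v)"
      by (simp add: A_simps complex_vector.scale_right_diff_distrib)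
    also have "\<dots> = (v - cis t *\<^sub>C A v) - (v - cis s *\<^sub>C A v)" using u v by simp
    also have "\<dots> = (cis s - cis t) *\<^sub>C A v" by (simp add: complex_vector.scale_left_diff_distrib)
    finally have "norm (u - v) \<le> C * norm ((cis s - cis t) *\<^sub>C A v)"
      using C(2)[of "cis s" "u - v"] by simp
    also have "norm ((cis s - cis t) *\<^sub>C A v) \<le> \<bar>s - t\<bar> * (K * norm v)"
      unfolding norm_scaleC by (intro mult_mono norm_cis_diff_le K) auto
    also have "norm v \<le> C * norm x" using C(2)[of "cis t" v] v by simp
    finally have "norm (u - v) \<le> C * (\<bar>s - t\<bar> * (K * (C * norm x)))"
      using C(1) K(1) by (simp add: mult_left_mono)
    then show ?thesis by (simp add: u_def v_def mult_ac)
  qed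
  then show ?thesis using that[of "C * K * C"] C(1) K(1) by simp
qed

text \<open>\<open>G j t\<close> is the average of the resolvents at the \<open>2\<^sup>j\<close> angles \<open>t + 2 \<pi> k / 2\<^sup>j\<close>, that is the trapezoidal
sum for the Riesz integral on a grid rotated by \<open>t\<close>. Refining the grid adds the same grid rotated by
half a step, which is \<open>\<pi> / 2\<^sup>j\<close>.\<close>

primrec G :: "nat \<Rightarrow> real \<Rightarrow> 'a \<Rightarrow> 'a" where
  "G 0 t x = R (cis t) x"
| "G (Suc j) t x = (1/2) *\<^sub>C (G j t x + G j (t + pi / 2 ^ j) x)"

definition V :: "nat \<Rightarrow> 'a \<Rightarrow> 'a" where
  "V j = A ^^ (2 ^ j)"

lemma V_0: "V 0 = A" by (simp add: V_def)

lemma V_Suc: "V (Suc j) x = V j (V j x)"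
  by (simp add: V_def mult_2 funpow_add)

lemma V_bounded_operator: "bounded_operator_on UNIV (V j)"
proof (induction j)
  case 0 then show ?case using A by (simp add: V_0)
next
  case (Suc j)
  have "V (Suc j) = (\<lambda>x. V j (V j x))" by (rule ext) (rule V_Suc)
  then show ?case using bounded_operator_on_compose[OF Suc Suc] by simp
qed

lemmas V_simps = bounded_operator_on_add[OF V_bounded_operator]
  bounded_operator_on_scaleC[OF V_bounded_operator]
  bounded_operator_on_diff[OF V_bounded_operator]

text \<open>The two factorisations of \<open>1 - w\<^sup>2\<close> for \<open>w = c V j\<close>.\<close>

lemma one_minus_V_square:
  "x - (c * c) *\<^sub>C V (Suc j) x = (x + c *\<^sub>C V j x) - c *\<^sub>C V j (x + c *\<^sub>C V j x)"
  "x - (c * c) *\<^sub>C V (Suc j) x = (x - c *\<^sub>C V j x) + c *\<^sub>C V j (x - c *\<^sub>C V j x)"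
  by (simp_all add: V_Suc V_simps scaleC_add_right scaleC_scaleC complex_vector.scale_right_diff_distrib)

lemma cis_half_period: "cis (2 ^ j * (t + pi / 2 ^ j)) = - cis (2 ^ j * t)"
proof -
  have "2 ^ j * (t + pi / 2 ^ j) = 2 ^ j * t + pi" by (simp add: field_simps)
  then have "cis (2 ^ j * (t + pi / 2 ^ j)) = cis (2 ^ j * t) * cis pi" by (simp only: cis_mult)
  then show ?thesis by simp
qed

lemma G_bounded_operator: "bounded_operator_on UNIV (G j t)"
proof (induction j arbitrary: t)
  case 0
  have "G 0 t = R (cis t)" by (rule ext) simp
  then show ?case using R_bounded_operator[of "cis t"] by simp
next
  case (Suc j)
  have "G (Suc j) t = (\<lambda>x. (1/2) *\<^sub>C G j t x + (1/2) *\<^sub>C G j (t + pi / 2 ^ j) x)"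
    by (rule ext) (simp add: scaleC_add_right)
  then show ?case using bounded_operator_on_combination[OF Suc Suc] by simp
qed

lemma half_plus_half: "(1/2) *\<^sub>C (x + x) = (x::'a)"
  by (simp add: scaleC_add_right scaleC_one flip: scaleC_add_left)

text \<open>Half a step of rotation turns \<open>cis (2\<^sup>j t)\<close> into its negative, so with \<open>w = cis (2\<^sup>j t) V j\<close> the
induction step is the partial fraction identity \<open>1/(1 - w\<^sup>2) = (1/(1 - w) + 1/(1 + w)) / 2\<close>.\<close>

lemma G_inverse:
  "G j t x - cis (2 ^ j * t) *\<^sub>C V j (G j t x) = x"
  "G j t (x - cis (2 ^ j * t) *\<^sub>C V j x) = x"
proof -
  have "(\<forall>x. G j t x - cis (2 ^ j * t) *\<^sub>C V j (G j t x) = x) \<and>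
    (\<forall>x. G j t (x - cis (2 ^ j * t) *\<^sub>C V j x) = x)"
  proof (induction j arbitrary: t)
    case 0 show ?case by (simp add: V_0 one_minus_R R_one_minus)
  next
    case (Suc j)
    define c where "c = cis (2 ^ j * t)"
    define G1 G2 where "G1 = G j t" and "G2 = G j (t + pi / 2 ^ j)"
    have "2 ^ Suc j * t = 2 ^ j * t + 2 ^ j * t" by simp
    then have cc: "cis (2 ^ Suc j * t) = c * c" by (simp only: c_def cis_mult)
    have g1: "G1 x - c *\<^sub>C V j (G1 x) = x" "G1 (x - c *\<^sub>C V j x) = x" for x
      using Suc[of t] by (simp_all add: G1_def c_def)
    have g2: "G2 x + c *\<^sub>C V j (G2 x) = x" "G2 (x + c *\<^sub>C V j x) = x" for x
      using Suc[of "t + pi / 2 ^ j"] by (simp_all add: G2_def c_def cis_half_period)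
    have G: "G (Suc j) t x = (1/2) *\<^sub>C (G1 x + G2 x)" for x by (simp add: G1_def G2_def)
    have W: "bounded_operator_on UNIV (\<lambda>x. x - (c * c) *\<^sub>C V (Suc j) x)"
      by (rule bounded_operator_on_one_minus[OF V_bounded_operator]) simp
    have 1: "G (Suc j) t x - cis (2 ^ Suc j * t) *\<^sub>C V (Suc j) (G (Suc j) t x) = x" for x
    proof -
      have "(1/2) *\<^sub>C (G1 x + G2 x) - (c * c) *\<^sub>C V (Suc j) ((1/2) *\<^sub>C (G1 x + G2 x))
        = (1/2) *\<^sub>C ((G1 x - (c * c) *\<^sub>C V (Suc j) (G1 x)) + (G2 x - (c * c) *\<^sub>C V (Suc j) (G2 x)))"
        using bounded_operator_on_scaleC[OF W] bounded_operator_on_add[OF W] by (metis UNIV_I)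
      also have "\<dots> = (1/2) *\<^sub>C ((x + c *\<^sub>C V j x) + (x - c *\<^sub>C V j x))"
        unfolding one_minus_V_square(2)[of "G1 x"] one_minus_V_square(1)[of "G2 x"] g1(1) g2(1) by simp
      also have "\<dots> = x" using half_plus_half[of x] by simp
      finally show ?thesis unfolding G cc .
    qed
    have "G1 (x - (c * c) *\<^sub>C V (Suc j) x) = x + c *\<^sub>C V j x" for x
      unfolding one_minus_V_square(1) g1(2) ..
    moreover have "G2 (x - (c * c) *\<^sub>C V (Suc j) x) = x - c *\<^sub>C V j x" for x
      unfolding one_minus_V_square(2) g2(2) ..
    ultimately have "G (Suc j) t (x - cis (2 ^ Suc j * t) *\<^sub>C V (Suc j) x) = x" for x
      unfolding G cc using half_plus_half[of x] by simp
    with 1 show ?case by blast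
  qed
  then show "G j t x - cis (2 ^ j * t) *\<^sub>C V j (G j t x) = x"
    "G j t (x - cis (2 ^ j * t) *\<^sub>C V j x) = x" by blast+
qed

text \<open>The product form \<open>1/(1 - w\<^sup>2) = 1/(1 - w) \<cdot> 1/(1 + w)\<close>, from which the limit of the \<open>G j 0\<close> inherits
idempotence.\<close>

lemma G_Suc_factor: "G (Suc j) 0 x = G j 0 (G j (pi / 2 ^ j) x)"
proof -
  define y where "y = G j 0 (G j (pi / 2 ^ j) x)"
  have 1: "y - V j y = G j (pi / 2 ^ j) x"
    using G_inverse(1)[of j 0] by (simp add: y_def scaleC_one)
  have 2: "z + V j z = x" if "z = G j (pi / 2 ^ j) x" for z
    using G_inverse(1)[of j "pi / 2 ^ j" x] that cis_half_period[of j 0] by (simp add: scaleC_one)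
  have "y - V (Suc j) y = x"
    using one_minus_V_square(2)[of y 1 j] 2[OF 1] by (simp add: scaleC_one)
  then show ?thesis
    using G_inverse(2)[of "Suc j" 0 y] by (simp add: scaleC_one y_def)
qed

lemma G_commute_A: "G j 0 (A x) = A (G j 0 x)"
proof -
  have AV: "A (V j y) = V j (A y)" for y
    by (simp add: V_def funpow_swap1)
  have "A x = A (G j 0 x) - V j (A (G j 0 x))"
    using G_inverse(1)[of j 0 x] by (metis A_simps(3) AV UNIV_I cis_zero complex_vector.subspace_UNIV mult_zero_right scaleC_one)
  then show ?thesis
    using G_inverse(2)[of j 0 "A (G j 0 x)"] by (simp add: scaleC_one)
qed

text \<open>Averaging does not increase a Lipschitz constant, so one constant serves all grids.\<close>

lemma G_Lipschitz:
  obtains L where "L > 0" "\<And>j s t x. norm (G j s x - G j t x) \<le> L * \<bar>s - t\<bar> * norm x"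
proof -
  obtain L where L: "L > 0" "\<And>s t x. norm (R (cis s) x - R (cis t) x) \<le> L * \<bar>s - t\<bar> * norm x"
    using R_Lipschitz by blast
  have "norm (G j s x - G j t x) \<le> L * \<bar>s - t\<bar> * norm x" for j s t x
  proof (induction j arbitrary: s t)
    case 0 then show ?case using L(2) by simp
  next
    case (Suc j)
    define h where "h = pi / 2 ^ j"
    have "G (Suc j) s x - G (Suc j) t x
        = (1/2) *\<^sub>C ((G j s x - G j t x) + (G j (s + h) x - G j (t + h) x))"
      by (simp add: h_def complex_vector.scale_right_diff_distrib scaleC_add_right)
    then have "norm (G (Suc j) s x - G (Suc j) t x)
        = 1/2 * norm ((G j s x - G j t x) + (G j (s + h) x - G j (t + h) x))"
      by (simp add: norm_scaleC norm_divide)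
    also have "\<dots> \<le> 1/2 * (L * \<bar>s - t\<bar> * norm x + L * \<bar>(s + h) - (t + h)\<bar> * norm x)"
      by (intro mult_left_mono norm_triangle_mono Suc) auto
    also have "\<dots> = L * \<bar>s - t\<bar> * norm x" by simp
    finally show ?case .
  qed
  then show ?thesis using that L(1) by blast
qed

text \<open>Two consecutive averages differ by half the effect of a rotation by \<open>\<pi> / 2\<^sup>j\<close>, so by the uniform
Lipschitz bound they differ by \<open>O(1 / 2\<^sup>j)\<close> in norm and converge. The rotated averages \<open>G j (\<pi> / 2\<^sup>j)\<close>
have the same limit \<open>P\<close>, so \<open>G_Suc_factor\<close> becomes \<open>P = P \<circ> P\<close> in the limit.\<close>

lemma Riesz_projection:
  obtains P C where "bounded_operator_on UNIV P" "\<And>x. P (P x) = P x" "\<And>x. P (A x) = A (P x)"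
    "\<And>j x. norm (P x - G j 0 x) \<le> C / 2 ^ j * norm x"
proof -
  obtain L where L: "L > 0" "\<And>j s t x. norm (G j s x - G j t x) \<le> L * \<bar>s - t\<bar> * norm x"
    using G_Lipschitz by blast
  define C where "C = L * pi"
  have C: "C > 0" using L(1) by (simp add: C_def)
  have half_turn: "norm (G j (pi / 2 ^ j) x - G j 0 x) \<le> C / 2 ^ j * norm x" for j x
    using L(2)[of j "pi / 2 ^ j" x 0] by (simp add: C_def)
  have step: "norm (G (Suc j) 0 x - G j 0 x) \<le> C / 2 ^ Suc j * norm x" for j x
  proof -
    have "G (Suc j) 0 x - G j 0 x = (1/2) *\<^sub>C (G j 0 x + G j (pi / 2 ^ j) x)
        - (1/2) *\<^sub>C (G j 0 x + G j 0 x)"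
      unfolding half_plus_half by simp
    also have "\<dots> = (1/2) *\<^sub>C (G j (pi / 2 ^ j) x - G j 0 x)"
      by (simp flip: complex_vector.scale_right_diff_distrib)
    finally have "norm (G (Suc j) 0 x - G j 0 x) = 1/2 * norm (G j (pi / 2 ^ j) x - G j 0 x)"
      by (simp add: norm_scaleC norm_divide)
    then show ?thesis using half_turn[of j x] by simp
  qed
  have tele: "norm (G (j + k) 0 x - G j 0 x) \<le> C * (1 / 2 ^ j - 1 / 2 ^ (j + k)) * norm x" for j k x
  proof (induction k)
    case (Suc k)
    have "norm (G (j + Suc k) 0 x - G j 0 x)
        \<le> norm (G (Suc (j + k)) 0 x - G (j + k) 0 x) + norm (G (j + k) 0 x - G j 0 x)"
      by (metis add_Suc_right diff_add_cancel add_diff_eq norm_triangle_ineq)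
    also have "\<dots> \<le> C / 2 ^ Suc (j + k) * norm x + C * (1 / 2 ^ j - 1 / 2 ^ (j + k)) * norm x"
      by (intro add_mono step Suc)
    also have "\<dots> = C * (1 / 2 ^ j - 1 / 2 ^ (j + Suc k)) * norm x"
      by (simp add: algebra_simps)
    finally show ?case .
  qed simp
  have far: "norm (G m 0 x - G j 0 x) \<le> C / 2 ^ j * norm x" if "j \<le> m" for j m x
  proof -
    from that obtain k where m: "m = j + k" by (auto simp: le_iff_add)
    have "C * (1 / 2 ^ j - 1 / 2 ^ (j + k)) \<le> C * (1 / 2 ^ j)"
      using C by (intro mult_left_mono) auto
    then have "C * (1 / 2 ^ j - 1 / 2 ^ (j + k)) * norm x \<le> C * (1 / 2 ^ j) * norm x"
      by (rule mult_right_mono) simp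
    then show ?thesis using tele[of j k x] unfolding m by simp
  qed
  have small: "(\<lambda>j. C / 2 ^ j) \<longlonglongrightarrow> 0"
    by (rule LIMSEQ_divide_realpow_zero) simp
  define P where "P x = lim (\<lambda>j. G j 0 x)" for x
  have lim: "(\<lambda>j. G j 0 x) \<longlonglongrightarrow> P x" for x
  proof -
    have "Cauchy (\<lambda>j. G j 0 x)"
    proof (rule CauchyI')
      fix e :: real assume "e > 0"
      have "(\<lambda>j. C / 2 ^ j * norm x) \<longlonglongrightarrow> 0" by (rule tendsto_mult_left_zero[OF small])
      then obtain j where j: "C / 2 ^ j * norm x < e"
        using order_tendstoD(2)[OF _ \<open>e > 0\<close>] eventually_happens' by (metis sequentially_bot)
      have *: "C / 2 ^ m * norm x \<le> C / 2 ^ j * norm x" if "m \<ge> j" for m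
        using C that by (intro mult_right_mono divide_left_mono power_increasing) auto
      have "dist (G m 0 x) (G n 0 x) < e" if "m \<ge> j" "n > m" for m n
        using far[of m n x] *[of m] j that by (simp add: dist_norm norm_minus_commute)
      then show "\<exists>M. \<forall>m\<ge>M. \<forall>n>m. dist (G m 0 x) (G n 0 x) < e" by blast
    qed
    then show ?thesis unfolding P_def using Cauchy_convergent convergent_LIMSEQ_iff by blast
  qed
  have close: "norm (P x - G j 0 x) \<le> C / 2 ^ j * norm x" for j x
    by (rule Lim_bounded[OF tendsto_norm[OF tendsto_diff[OF lim tendsto_const]], of j]) (use far in blast)
  have P: "bounded_operator_on UNIV P"
  proof -
    obtain K where K: "K > 0" "\<And>x. norm (G 0 0 x) \<le> K * norm x"
      using bounded_operator_on_bound[OF G_bounded_operator, of 0 0] by auto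
    have "norm (P x) \<le> (C + K) * norm x" for x
      using norm_triangle_ineq[of "P x - G 0 0 x" "G 0 0 x"] close[of x 0] K(2)[of x]
      by (simp add: algebra_simps)
    moreover have "P (x + y) = P x + P y" for x y
      using LIMSEQ_unique[OF lim[of "x + y"]] tendsto_add[OF lim[of x] lim[of y]]
      by (simp add: bounded_operator_on_add[OF G_bounded_operator])
    moreover have "P (c *\<^sub>C x) = c *\<^sub>C P x" for c x
    proof -
      have "bounded_operator_on UNIV (\<lambda>x::'a. c *\<^sub>C x)"
        using bounded_operator_on_combination[OF bounded_operator_on_id bounded_operator_on_id, of UNIV c 0]
        by simp
      from bounded_operator_on_tendsto[OF this _ lim[of x]]
      have "(\<lambda>j. c *\<^sub>C G j 0 x) \<longlonglongrightarrow> c *\<^sub>C P x" by simp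
      then show ?thesis
        using LIMSEQ_unique[OF lim[of "c *\<^sub>C x"]]
        by (simp add: bounded_operator_on_scaleC[OF G_bounded_operator])
    qed
    ultimately show ?thesis unfolding bounded_operator_on_def by auto
  qed
  have "P (A x) = A (P x)" for x
    using LIMSEQ_unique[OF lim[of "A x"]] bounded_operator_on_tendsto[OF A _ lim[of x]]
    by (simp add: G_commute_A)
  moreover have "P (P x) = P x" for x
  proof -
    define y where "y j = G j (pi / 2 ^ j) x" for j
    have "(\<lambda>j. y j - G j 0 x) \<longlonglongrightarrow> 0"
      by (rule Lim_null_comparison[OF always_eventually[OF allI] tendsto_mult_left_zero[OF small]])
        (use half_turn in \<open>simp add: y_def\<close>)
    from tendsto_add[OF this lim[of x]] have y: "y \<longlonglongrightarrow> P x" by simp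
    have "(\<lambda>j. C / 2 ^ j * norm (y j)) \<longlonglongrightarrow> 0 * norm (P x)"
      by (intro tendsto_mult small tendsto_norm y)
    then have "(\<lambda>j. C / 2 ^ j * norm (y j)) \<longlonglongrightarrow> 0" by simp
    then have diff: "(\<lambda>j. P (y j) - G j 0 (y j)) \<longlonglongrightarrow> 0"
      by (rule Lim_null_comparison[OF always_eventually[OF allI[OF close]]])
    have "(\<lambda>j. P (y j)) \<longlonglongrightarrow> P (P x)"
      by (rule bounded_operator_on_tendsto[OF P _ y]) auto
    note tendsto_diff[OF this diff]
    moreover have "P (y j) - (P (y j) - G j 0 (y j)) = G (Suc j) 0 x" for j
      unfolding G_Suc_factor y_def by (rule diff_diff_eq2[THEN trans]) simp
    ultimately have "(\<lambda>j. G (Suc j) 0 x) \<longlonglongrightarrow> P (P x)"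
      by (simp only: diff_zero)
    then show ?thesis by (rule LIMSEQ_unique[OF _ LIMSEQ_Suc[OF lim[of x]]])
  qed
  ultimately show ?thesis using that P close by blast
qed

lemma V_image_subset:
  assumes "A ` M \<subseteq> M"
  shows "V j ` M \<subseteq> M"
proof (induction j)
  case 0 then show ?case using assms by (simp add: V_0)
next
  case (Suc j) then show ?case by (auto simp: V_Suc)
qed

section \<open>Splitting the space\<close>

lemma bij_betw_V_imp_bij_betw_A:
  assumes AM: "A ` M \<subseteq> M" and "bij_betw (V j) M M"
  shows "bij_betw A M M"
  using assms(2)
proof (induction j)
  case 0 then show ?case by (simp add: V_0)
next
  case (Suc j)
  have eq: "V (Suc j) = (\<lambda>x. V j (V j x))" by (rule ext) (rule V_Suc)
  have "inj_on (V j) M"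
    using Suc.prems unfolding eq bij_betw_def inj_on_def by metis
  moreover have "M \<subseteq> V j ` M"
  proof
    fix y assume "y \<in> M"
    then obtain x where "x \<in> M" "y = V j (V j x)"
      using Suc.prems unfolding eq bij_betw_def by blast
    then show "y \<in> V j ` M" using V_image_subset[OF AM, of j] by blast
  qed
  ultimately have "bij_betw (V j) M M"
    using V_image_subset[OF AM, of j] by (auto simp: bij_betw_def)
  then show ?case by (rule Suc.IH)
qed

text \<open>If \<open>1 - w\<^sup>2\<close> is bijective then so is its factor \<open>1 - w\<close>, because the factors commute. Repeating this
leads from \<open>(c A)\<^bsup>2^j\<^esup>\<close> down to \<open>c A\<close>.\<close>

lemma bij_betw_one_minus_V_imp_bij_betw_one_minus_A:
  assumes N: "complex_vector.subspace N" and AN: "A ` N \<subseteq> N"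
    and "bij_betw (\<lambda>x. x - c ^ (2 ^ j) *\<^sub>C V j x) N N"
  shows "bij_betw (\<lambda>x. x - c *\<^sub>C A x) N N"
  using assms(3)
proof (induction j)
  case 0 then show ?case by (simp add: V_0)
next
  case (Suc j)
  define d where "d = c ^ (2 ^ j)"
  define W where "W x = x - d *\<^sub>C V j x" for x
  define W' where "W' x = x + d *\<^sub>C V j x" for x
  have VN: "V j x \<in> N" if "x \<in> N" for x using V_image_subset[OF AN, of j] that by blast
  have W: "W x \<in> N" "W' x \<in> N" if "x \<in> N" for x
    unfolding W_def W'_def using that
    by (auto intro!: complex_vector.subspace_diff[OF N] complex_vector.subspace_add[OF N]
        complex_vector.subspace_scale[OF N] VN)
  have dd: "c ^ (2 ^ Suc j) = d * d" by (simp add: d_def mult_2 power_add)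
  have eq: "x - c ^ (2 ^ Suc j) *\<^sub>C V (Suc j) x = W (W' x)"
    "x - c ^ (2 ^ Suc j) *\<^sub>C V (Suc j) x = W' (W x)" for x
    unfolding dd W_def W'_def by (rule one_minus_V_square)+
  have "inj_on W N"
    using Suc.prems unfolding eq(2) bij_betw_def inj_on_def by metis
  moreover have "N \<subseteq> W ` N"
  proof
    fix y assume "y \<in> N"
    then obtain x where "x \<in> N" "y = W (W' x)"
      using Suc.prems unfolding eq(1) bij_betw_def by blast
    then show "y \<in> W ` N" using W by blast
  qed
  ultimately have "bij_betw W N N" using W by (auto simp: bij_betw_def)
  then show ?case using Suc.IH unfolding W_def d_def by blast
qed

text \<open>Take \<open>j\<close> with \<open>H = 1/(1 - V j)\<close> within \<open>1/3\<close> of \<open>P\<close>. On the kernel \<open>M\<close> of \<open>P\<close> the operator \<open>H\<close> is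
small, so \<open>V j H = H V j = H - 1\<close> is bijective. On the range \<open>N\<close> of \<open>P\<close> the operator \<open>H\<close> is close to \<open>1\<close>,
so \<open>V j = 1 - 1/H\<close> is small and \<open>1 - c V j\<close> is bijective whenever \<open>\<bar>c\<bar> \<le> 1\<close>. In both cases the
property of the power \<open>V j\<close> passes down to \<open>A\<close>.\<close>

theorem Riesz_splitting:
  obtains M N where "(M, N) \<in> Red A" "bij_betw A M M"
    "\<And>\<mu>. cmod \<mu> \<ge> 1 \<Longrightarrow> bij_betw (\<lambda>x. A x - \<mu> *\<^sub>C x) N N"
proof -
  obtain P C where P: "bounded_operator_on UNIV P" and PP: "\<And>x. P (P x) = P x"
    and PA: "\<And>x. P (A x) = A (P x)" and close: "\<And>j x. norm (P x - G j 0 x) \<le> C / 2 ^ j * norm x"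
    using Riesz_projection by blast
  have P_simps: "P (x + y) = P x + P y" "P (x - y) = P x - P y" "P (c *\<^sub>C x) = c *\<^sub>C P x"
    "P 0 = 0" for x y c
    using bounded_operator_on_add[OF P] bounded_operator_on_diff[OF P]
      bounded_operator_on_scaleC[OF P] bounded_operator_on_zero[OF P] by auto
  have P_lim: "(\<lambda>n. P (f n)) \<longlonglongrightarrow> P x" if "f \<longlonglongrightarrow> x" for f x
    using bounded_operator_on_tendsto[OF P _ that] by simp
  define M where "M = {x. P x = 0}"
  define N where "N = {x. P x = x}"
  have M: "complex_vector.subspace M"
    by (rule complex_vector.subspaceI) (auto simp: M_def P_simps)
  have N: "complex_vector.subspace N"
    by (rule complex_vector.subspaceI) (auto simp: N_def P_simps)
  have clM: "closed M"
    unfolding closed_sequential_limits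
  proof (intro allI impI, elim conjE)
    fix f l assume f: "\<forall>n. f n \<in> M" "f \<longlonglongrightarrow> l"
    then have "(\<lambda>n. P (f n)) = (\<lambda>n. 0)" by (auto simp: M_def)
    with P_lim[OF f(2)] show "l \<in> M" by (simp add: M_def LIMSEQ_const_iff)
  qed
  have clN: "closed N"
    unfolding closed_sequential_limits
  proof (intro allI impI, elim conjE)
    fix f l assume f: "\<forall>n. f n \<in> N" "f \<longlonglongrightarrow> l"
    then have "(\<lambda>n. P (f n)) = f" by (auto simp: N_def)
    with P_lim[OF f(2)] f(2) show "l \<in> N" by (simp add: N_def LIMSEQ_unique)
  qed
  have AM: "A ` M \<subseteq> M" and AN: "A ` N \<subseteq> N"
    using bounded_operator_on_zero[OF A] by (auto simp: M_def N_def PA)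
  have int: "M \<inter> N = {0}" by (auto simp: M_def N_def P_simps)
  have sum: "\<exists>m\<in>M. \<exists>n\<in>N. x = m + n" for x
    by (rule bexI[of _ "x - P x"], rule bexI[of _ "P x"]) (auto simp: M_def N_def PP P_simps)
  have red: "(M, N) \<in> Red A"
    using M N clM clN AM AN int sum by (auto simp: Red_def closed_invariant_subspace_def)

  have "(\<lambda>j. C / 2 ^ j) \<longlonglongrightarrow> 0"
    by (rule LIMSEQ_divide_realpow_zero) simp
  then obtain j where j: "C / 2 ^ j < 1/3"
    using order_tendstoD(2)[of _ 0 sequentially "1/3"] eventually_happens'
    by (metis sequentially_bot zero_less_divide_1_iff zero_less_numeral)
  define H where "H = G j 0"
  define W where "W x = x - V j x" for x
  have H: "bounded_operator_on UNIV H" unfolding H_def by (rule G_bounded_operator)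
  have PH: "norm (P x - H x) \<le> 1/3 * norm x" for x
  proof -
    have "C / 2 ^ j * norm x \<le> 1/3 * norm x" using j by (intro mult_right_mono) auto
    then show ?thesis unfolding H_def by (rule order_trans[OF close])
  qed
  have WH: "W (H x) = x" and HW: "H (W x) = x" for x
    using G_inverse[of j 0] by (simp_all add: W_def H_def scaleC_one)
  have W_bounded: "bounded_operator_on UNIV W"
    using bounded_operator_on_one_minus[OF V_bounded_operator, of 1 j]
    by (simp add: W_def[abs_def] scaleC_one)
  note VM = V_image_subset[OF AM, of j] and VN = V_image_subset[OF AN, of j]
  have "(M, N) \<in> Red W"
    using red VM VN unfolding Red_def closed_invariant_subspace_def W_def
    by (auto intro!: complex_vector.subspace_diff)
  moreover have "bij W" using WH HW by (intro o_bij[of H]) auto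
  ultimately have bijW: "bij_betw W M M" "bij_betw W N N"
    using Red_bij_betw[OF _ W_bounded] by blast+

  have HM: "H ` M \<subseteq> M"
  proof
    fix y assume "y \<in> H ` M"
    then obtain z where "z \<in> M" "y = H z" by blast
    moreover from this obtain x where "x \<in> M" "z = W x" using bijW(1) by (auto simp: bij_betw_def)
    ultimately have "x \<in> M" "y = H (W x)" by auto
    then show "y \<in> M" using HW by simp
  qed
  have H_small: "norm (H x) \<le> 1/3 * norm x" if "x \<in> M" for x
    using PH[of x] that by (simp add: M_def)
  have bijH: "bij_betw (\<lambda>x. x - H x) M M"
    by (rule bij_betw_one_minus_contraction[OF M clM bounded_operator_on_restrict[OF H HM], of "1/3"])
      (use H_small in auto)
  have VH: "V j (H x) = H x - x" for x using WH[of x] by (simp add: W_def algebra_simps)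
  have HV: "H (V j x) = H x - x" for x
    using HW[of x] bounded_operator_on_diff[OF H, of x "V j x"] by (simp add: W_def algebra_simps)
  have "inj_on (V j) M"
  proof (rule inj_onI)
    fix x y assume "x \<in> M" "y \<in> M" "V j x = V j y"
    moreover from this have "x - H x = y - H y" using HV[of x] HV[of y] by (simp add: algebra_simps)
    ultimately show "x = y" using bijH by (auto simp: bij_betw_def dest: inj_onD)
  qed
  moreover have "M \<subseteq> V j ` M"
  proof
    fix y assume "y \<in> M"
    then have "- y \<in> (\<lambda>x. x - H x) ` M"
      using bijH complex_vector.subspace_neg[OF M] by (auto simp: bij_betw_def)
    then obtain x where x: "x \<in> M" "- y = x - H x" by blast
    then have "y = V j (H x)" unfolding VH by (metis minus_diff_eq minus_minus)
    then show "y \<in> V j ` M" using HM x(1) by blast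
  qed
  ultimately have "bij_betw (V j) M M" using VM by (auto simp: bij_betw_def)
  then have bijA: "bij_betw A M M" by (rule bij_betw_V_imp_bij_betw_A[OF AM])

  \<comment> \<open>With \<open>x = y - V j y\<close> one has \<open>H x = y\<close>, so \<open>\<parallel>V j y\<parallel> = \<parallel>H x - x\<parallel> \<le> \<parallel>x\<parallel> / 3 \<le> (\<parallel>y\<parallel> + \<parallel>V j y\<parallel>) / 3\<close>.\<close>
  have V_small: "norm (V j y) \<le> 1/2 * norm y" if "y \<in> N" for y
  proof -
    have "W y \<in> N" using bijW(2) that by (auto simp: bij_betw_def)
    then have "norm (W y - y) \<le> 1/3 * norm (W y)" using PH[of "W y"] by (simp add: N_def HW)
    then have "norm (V j y) \<le> 1/3 * norm (y - V j y)" by (simp add: W_def)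
    then show ?thesis using norm_triangle_ineq4[of y "V j y"] by linarith
  qed
  have "bij_betw (\<lambda>x. A x - \<mu> *\<^sub>C x) N N" if mu: "cmod \<mu> \<ge> 1" for \<mu>
  proof -
    define c where "c = 1 / \<mu>"
    have c: "cmod (c ^ (2 ^ j)) \<le> 1"
      using mu unfolding c_def norm_power by (intro power_le_one) (auto simp: norm_divide divide_le_eq_1)
    have "\<mu> \<noteq> 0" using mu by auto
    have cV: "bounded_operator_on N (\<lambda>x. c ^ (2 ^ j) *\<^sub>C V j x)"
      using bounded_operator_on_combination[OF
          bounded_operator_on_restrict[OF V_bounded_operator VN] bounded_operator_on_id N, of "c ^ (2 ^ j)" 0]
      by simp
    have "bij_betw (\<lambda>x. x - c ^ (2 ^ j) *\<^sub>C V j x) N N"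
    proof (rule bij_betw_one_minus_contraction[OF N clN cV, of "1/2"])
      fix x assume "x \<in> N"
      have "norm (c ^ (2 ^ j) *\<^sub>C V j x) \<le> 1 * (1/2 * norm x)"
        unfolding norm_scaleC using c V_small[OF \<open>x \<in> N\<close>] by (intro mult_mono) auto
      then show "norm (c ^ (2 ^ j) *\<^sub>C V j x) \<le> 1/2 * norm x" by simp
    qed auto
    then have "bij_betw (\<lambda>x. x - c *\<^sub>C A x) N N"
      by (rule bij_betw_one_minus_V_imp_bij_betw_one_minus_A[OF N AN])
    moreover have "bij_betw (\<lambda>x. (- \<mu>) *\<^sub>C x) N N"
      by (rule bij_betw_byWitness[where f'="\<lambda>x. (- c) *\<^sub>C x"])
        (use \<open>\<mu> \<noteq> 0\<close> in \<open>auto simp: c_def scaleC_scaleC scaleC_one simp del: complex_vector.scale_minus_left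
          intro!: complex_vector.subspace_scale[OF N]\<close>)
    ultimately have "bij_betw ((\<lambda>x. (- \<mu>) *\<^sub>C x) \<circ> (\<lambda>x. x - c *\<^sub>C A x)) N N"
      by (rule bij_betw_trans)
    moreover have "(\<lambda>x. (- \<mu>) *\<^sub>C x) \<circ> (\<lambda>x. x - c *\<^sub>C A x) = (\<lambda>x. A x - \<mu> *\<^sub>C x)"
      using \<open>\<mu> \<noteq> 0\<close>
      by (auto simp: c_def complex_vector.scale_right_diff_distrib scaleC_scaleC scaleC_one)
    ultimately show ?thesis by simp
  qed
  then show ?thesis using that red bijA by blast
qed

end

section \<open>Second accumulation points of the spectrum\<close>

lemma spectrum_shift:
  "spectrum_on M (\<lambda>x. T x - \<mu> *\<^sub>C x) = (\<lambda>z. z - \<mu>) ` spectrum_on M T"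
proof -
  have "z \<in> spectrum_on M (\<lambda>x. T x - \<mu> *\<^sub>C x) \<longleftrightarrow> z + \<mu> \<in> spectrum_on M T" for z
    by (simp add: spectrum_on_def scaleC_add_left algebra_simps)
  then show ?thesis by (force simp: image_iff intro: bexI[of _ "_ + \<mu>"])
qed

lemma acc_translation: "acc ((\<lambda>z. z - \<mu>) ` A) = (\<lambda>z. z - \<mu>) ` acc A"
proof -
  have *: "z - \<mu> \<in> acc ((\<lambda>z. z - \<mu>) ` A)" if "z \<in> acc A" for z \<mu> A
    using that unfolding acc_def islimpt_approachable by (auto simp: dist_norm)
  have "z \<in> (\<lambda>z. z - \<mu>) ` acc A" if "z \<in> acc ((\<lambda>z. z - \<mu>) ` A)" for z
    using *[OF that, of "- \<mu>"] by (auto simp: image_image intro: image_eqI[of _ _ "z + \<mu>"])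
  then show ?thesis using * by blast
qed

text \<open>A closed annulus around \<open>0\<close> inside the disc where \<open>acc S\<close> reduces to \<open>0\<close> contains only finitely many
points of \<open>S\<close>, by Bolzano-Weierstrass, so most radii are not moduli of points of \<open>S\<close>.\<close>

lemma isolated_limit_point_imp_missed_circle:
  fixes S :: "complex set"
  assumes "0 \<notin> acc (acc S)"
  obtains r where "r > 0" "\<And>z. z \<in> S \<Longrightarrow> cmod z \<noteq> r" "acc S \<inter> cball 0 r \<subseteq> {0}"
proof -
  obtain \<epsilon> where e: "\<epsilon> > 0" "\<And>z. z \<in> acc S \<Longrightarrow> z \<noteq> 0 \<Longrightarrow> cmod z \<ge> \<epsilon>"
    using assms unfolding acc_def[of "acc S"] islimpt_approachable by (force simp: not_less)
  define K where "K = cball (0::complex) (\<epsilon>/2) - ball 0 (\<epsilon>/3)"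
  have "compact K" unfolding K_def by (intro compact_diff) auto
  have "finite (S \<inter> K)"
  proof (rule ccontr)
    assume "infinite (S \<inter> K)"
    then obtain z where z: "z \<in> K" "z islimpt (S \<inter> K)"
      using \<open>compact K\<close> unfolding compact_eq_Bolzano_Weierstrass by (metis inf_le2)
    then have "z \<in> acc S" unfolding acc_def using islimpt_subset by blast
    then show False using e z(1) by (force simp: K_def)
  qed
  then have "infinite ({\<epsilon>/3<..<\<epsilon>/2} - cmod ` (S \<inter> K))"
    using e(1) by (intro Diff_infinite_finite) (auto simp: infinite_Ioo)
  then obtain r where r: "\<epsilon>/3 < r" "r < \<epsilon>/2" "r \<notin> cmod ` (S \<inter> K)"
    by (metis Diff_iff ex_in_conv finite.emptyI greaterThanLessThan_iff)
  show ?thesis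
  proof (rule that[of r])
    show "r > 0" using r(1) e(1) by linarith
    show "cmod z \<noteq> r" if "z \<in> S" for z using that r by (force simp: K_def)
    show "acc S \<inter> cball 0 r \<subseteq> {0}" using e r by force
  qed
qed

text \<open>The Riesz splitting for the circle of radius \<open>r\<close>, obtained from the unit circle by scaling with
\<open>1 / r\<close>.\<close>

lemma spectral_splitting:
  fixes T :: "'a::complex_banach \<Rightarrow> 'a"
  assumes T: "bounded_operator_on UNIV T" and r: "r > 0"
    and circle: "\<And>z. z \<in> spectrum T \<Longrightarrow> cmod z \<noteq> r"
  obtains M N where "(M, N) \<in> Red T" "bij_betw T M M"
    "spectrum_on N T \<subseteq> spectrum T \<inter> cball 0 r"
proof -
  define a where "a = complex_of_real (1 / r)"
  have a: "complex_of_real r * a = 1" "a \<noteq> 0" using r by (auto simp: a_def)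
  define A where "A x = a *\<^sub>C T x" for x
  have TA: "T x = complex_of_real r *\<^sub>C A x" for x
    unfolding A_def scaleC_scaleC a(1) scaleC_one ..
  have scale_bij: "bij_betw (\<lambda>x. c *\<^sub>C x) M M"
    if "complex_vector.subspace M" "c \<noteq> 0" for c and M :: "'a set"
    by (rule bij_betw_byWitness[where f'="\<lambda>x. (1 / c) *\<^sub>C x"])
      (use that in \<open>auto simp: scaleC_scaleC scaleC_one intro!: complex_vector.subspace_scale\<close>)
  interpret circle_avoiding_operator A
  proof
    show "bounded_operator_on UNIV A"
      using bounded_operator_on_combination[OF T bounded_operator_on_id, of a 0]
      by (simp add: A_def[abs_def])
    fix c :: complex assume c: "cmod c = 1"
    define \<mu> where "\<mu> = complex_of_real r / c"
    have "c \<noteq> 0" using c by auto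
    have "\<mu> \<notin> spectrum T" using circle[of \<mu>] c r by (auto simp: \<mu>_def norm_divide)
    then have "bij (\<lambda>x. T x - \<mu> *\<^sub>C x)" using spectrum_on_iff_not_bij_betw[OF _ _ T] by simp
    moreover have "bij (\<lambda>x::'a. (- (1 / \<mu>)) *\<^sub>C x)"
      using r \<open>c \<noteq> 0\<close> by (intro scale_bij) (auto simp: \<mu>_def)
    ultimately have "bij ((\<lambda>x. (- (1 / \<mu>)) *\<^sub>C x) \<circ> (\<lambda>x. T x - \<mu> *\<^sub>C x))" by (rule bij_comp)
    moreover have "(\<lambda>x. (- (1 / \<mu>)) *\<^sub>C x) \<circ> (\<lambda>x. T x - \<mu> *\<^sub>C x) = (\<lambda>x. x - c *\<^sub>C A x)"
      using r \<open>c \<noteq> 0\<close> by (auto simp: A_def a_def \<mu>_def scaleC_scaleC scaleC_one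
          complex_vector.scale_right_diff_distrib)
    ultimately show "bij (\<lambda>x. x - c *\<^sub>C A x)" by simp
  qed
  obtain M N where red: "(M, N) \<in> Red A" and M: "bij_betw A M M"
    and N: "\<And>\<mu>. cmod \<mu> \<ge> 1 \<Longrightarrow> bij_betw (\<lambda>x. A x - \<mu> *\<^sub>C x) N N"
    using Riesz_splitting by blast
  have TM: "T ` M \<subseteq> M" "T ` N \<subseteq> N"
    unfolding TA using RedD[OF red] by (auto intro!: complex_vector.subspace_scale)
  then have redT: "(M, N) \<in> Red T" using red by (simp add: Red_def closed_invariant_subspace_def)
  have scale: "bij_betw (\<lambda>x. complex_of_real r *\<^sub>C S x) L L"
    if "bij_betw S L L" "complex_vector.subspace L" for S and L :: "'a set"
    using bij_betw_trans[OF that(1) scale_bij[OF that(2), of "complex_of_real r"]] r by (simp add: o_def)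
  have "bij_betw T M M" using scale[OF M RedD(1)[OF red]] unfolding TA[symmetric] .
  moreover have "spectrum_on N T \<subseteq> spectrum T \<inter> cball 0 r"
  proof
    fix \<mu> assume mu: "\<mu> \<in> spectrum_on N T"
    then have not: "\<not> bij_betw (\<lambda>x. T x - \<mu> *\<^sub>C x) N N"
      using spectrum_on_iff_not_bij_betw[OF RedD(4,5)[OF redT] bounded_operator_on_restrict[OF T RedD(6)[OF redT]]]
      by simp
    have "\<not> bij (\<lambda>x. T x - \<mu> *\<^sub>C x)"
      using not Red_bij_betw(2)[OF Red_shift[OF redT] bounded_operator_on_shift[OF T]] by auto
    then have "\<mu> \<in> spectrum T" using spectrum_on_iff_not_bij_betw[OF _ _ T] by simp
    moreover have "cmod \<mu> < r"
    proof (rule ccontr)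
      assume "\<not> cmod \<mu> < r"
      then have "cmod (\<mu> / complex_of_real r) \<ge> 1" using r by (simp add: norm_divide)
      from scale[OF N[OF this] RedD(4)[OF red]]
      have "bij_betw (\<lambda>x. T x - \<mu> *\<^sub>C x) N N"
        using r by (simp add: complex_vector.scale_right_diff_distrib scaleC_scaleC flip: TA)
      then show False using not by simp
    qed
    ultimately show "\<mu> \<in> spectrum T \<inter> cball 0 r" by simp
  qed
  ultimately show ?thesis using that redT by blast
qed

text \<open>A single splitting serves both sides: on \<open>M\<close> the operator is invertible, hence surjective and
bounded below, and on \<open>N\<close> its spectrum accumulates only at points of \<open>acc \<sigma>(T)\<close> inside the disc.\<close>

lemma not_acc_acc_spectrum_imp_gz_invertible:
  fixes T :: "'a::complex_banach \<Rightarrow> 'a"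
  assumes T: "bounded_operator_on UNIV T" and "0 \<notin> acc (acc (spectrum T))"
  shows "gz_invertible T"
proof -
  obtain r where r: "r > 0" "\<And>z. z \<in> spectrum T \<Longrightarrow> cmod z \<noteq> r" "acc (spectrum T) \<inter> cball 0 r \<subseteq> {0}"
    using isolated_limit_point_imp_missed_circle[OF assms(2)] by blast
  obtain M N where red: "(M, N) \<in> Red T" and M: "bij_betw T M M"
    and N: "spectrum_on N T \<subseteq> spectrum T \<inter> cball 0 r"
    using spectral_splitting[OF T r(1,2)] by blast
  have "acc (spectrum_on N T) \<subseteq> acc (spectrum T) \<inter> acc (cball 0 r)"
    using N unfolding acc_def by (auto intro: islimpt_subset)
  also have "acc (cball 0 r) \<subseteq> cball 0 r"
    unfolding acc_def using closed_limpt closed_cball by blast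
  finally have zN: "zeroloid_on N T" using r(3) unfolding zeroloid_on_def by blast
  have TM: "bounded_operator_on M T"
    by (rule bounded_operator_on_restrict[OF T RedD(3)[OF red]])
  have surj: "surjective_on M T" using M by (simp add: surjective_on_def bij_betw_def)
  moreover have "bounded_below_on M T"
  proof -
    obtain K where K: "K > 0" "\<And>y. y \<in> M \<Longrightarrow> \<exists>x\<in>M. T x = y \<and> norm x \<le> K * norm y"
      using open_mapping_on[OF RedD(1,2)[OF red] TM] surj by (auto simp: surjective_on_def)
    have "norm x \<le> K * norm (T x)" if "x \<in> M" for x
      using K(2)[of "T x"] that M by (auto simp: bij_betw_def dest: inj_onD)
    then have "(1 / K) * norm x \<le> norm (T x)" if "x \<in> M" for x
      using that K(1) by (simp add: field_simps)
    then show ?thesis unfolding bounded_below_on_def using K(1) by (intro exI[of _ "1 / K"]) auto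
  qed
  ultimately show ?thesis
    unfolding gz_invertible_def left_gz_invertible_def right_gz_invertible_def
    using red zN by auto
qed

theorem theorem4p11:
  fixes T :: "'a::complex_banach \<Rightarrow> 'a"
  assumes "\<not> (\<exists>B::'a set. finite B \<and> complex_vector.span B = UNIV)"
    and "bounded_operator_on UNIV T"
  shows "gzd_spectrum T = acc (acc (spectrum T))"
proof -
  note T = assms(2)
  have "\<mu> \<in> gzd_spectrum T \<longleftrightarrow> \<mu> \<in> acc (acc (spectrum T))" for \<mu>
  proof -
    define S where "S x = T x - \<mu> *\<^sub>C x" for x
    have S: "bounded_operator_on UNIV S"
      unfolding S_def[abs_def] by (rule bounded_operator_on_shift[OF T]) simp
    have "acc (acc (spectrum S)) = (\<lambda>z. z - \<mu>) ` acc (acc (spectrum T))"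
      by (simp add: S_def[abs_def] spectrum_shift acc_translation)
    then have "0 \<in> acc (acc (spectrum S)) \<longleftrightarrow> \<mu> \<in> acc (acc (spectrum T))" by auto
    moreover have "gz_invertible S \<longleftrightarrow> 0 \<notin> acc (acc (spectrum S))"
      using gz_invertible_imp_not_acc_acc_spectrum[OF S] not_acc_acc_spectrum_imp_gz_invertible[OF S]
      by blast
    ultimately show ?thesis by (simp add: gzd_spectrum_def S_def[abs_def])
  qed
  then show ?thesis by blast
qed

end
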